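(* Let $v$ be a viscosity solution of $H(x,c+v_x)=h(c)$ on $\mathbb{T}^n$ corresponding to a KAM torus with a $(\nu,\eta)$-Diophantine rotation vector, and for $\varepsilon>0$ let $v^\varepsilon$ be the unique viscosity solution of $\varepsilon v^\varepsilon+H(x,c+v^\varepsilon_x)=h(c)$ on $\mathbb{T}^n$. Then there exists a constant $\beta>0$ independent of $\varepsilon$ such that, after adding to $v$ a constant which may depend on $\varepsilon$, $$\|v^\varepsilon-v\|_{C^0(\mathbb{T}^n)}\le\beta\,\varepsilon^{\frac{1}{1+2\eta}}\quad\text{as }\varepsilon\to0.$$
   Context: $H:\mathbb{T}^n\times\mathbb{R}^n\to\mathbb{R}$ is $C^2$, $H_{pp}$ is positive definite, $H(x,p)/|p|\to+\infty$ as $|p|\to\infty$ uniformly in $x$. $c\in\mathbb{R}^n$ is fixed and $h(c)$ is the unique constant for which $H(x,c+v_x)=h(c)$ has a viscosity solution on $\mathbb{T}^n$. $\phi^s_H$ is the flow of $x'=H_p(x,p)$, $p'=-H_x(x,p)$. $\mathrm{graph}(c+v_x):=\{(x,c+v_x(x)): v\text{ differentiable at }x\}$. "$v$ corresponds to a KAM torus with a $(\nu,\eta)$-Diophantine rotation vector $\omega\in\mathbb{R}^n$" means: $\mathrm{graph}(c+v_x)$ is a smooth $\phi^s_H$-invariant torus and there is a $C^1$ embedding $\Phi=(\varphi,\psi):\mathbb{T}^n\to\mathbb{T}^n\times\mathbb{R}^n$ with $\Phi(\mathbb{T}^n)=\mathrm{graph}(c+v_x)$ such that for every $(x_0,p_0)\in\mathrm{graph}(c+v_x)$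 there is $\theta_0\in\mathbb{T}^n$ (depending on $(x_0,p_0)$) with $\phi^s_H(x_0,p_0)=\Phi(\omega s+\theta_0)$ for all $s$, and $|\omega\cdot z|\ge\nu(|z_1|+\dots+|z_n|)^{-\eta}$ for all $z\in\mathbb{Z}^n\setminus\{0\}$, where $\nu>0$, $\eta>n-1$. *)

theory Defs
  imports "HOL-Analysis.Analysis"
begin

text \<open>The torus T^n is represented through Z^n-periodic lifts on real^'n.\<close>

definition int_vec :: "real^'n \<Rightarrow> bool" where
  "int_vec z \<longleftrightarrow> (\<forall>i. z $ i \<in> \<int>)"

definition tor_eq :: "real^'n \<Rightarrow> real^'n \<Rightarrow> bool" where
  "tor_eq x y \<longleftrightarrow> int_vec (x - y)"

definition periodic_fun :: "(real^'n \<Rightarrow> 'b) \<Rightarrow> bool" where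
  "periodic_fun f \<longleftrightarrow> (\<forall>x z. int_vec z \<longrightarrow> f (x + z) = f x)"

definition C1_map :: "('a::euclidean_space \<Rightarrow> 'b::real_normed_vector) \<Rightarrow> bool" where
  "C1_map f \<longleftrightarrow> (\<exists>f'. (\<forall>y. (f has_derivative blinfun_apply (f' y)) (at y)) \<and> continuous_on UNIV f')"

definition C2_fun :: "('a::euclidean_space \<Rightarrow> real) \<Rightarrow> bool" where
  "C2_fun f \<longleftrightarrow> (\<exists>G G'. (\<forall>z. (f has_derivative (\<lambda>k. G z \<bullet> k)) (at z)) \<and>
      (\<forall>z. (G has_derivative blinfun_apply (G' z)) (at z)) \<and> continuous_on UNIV G')"

definition pderiv_dir :: "'a::euclidean_space \<Rightarrow> ('a \<Rightarrow> 'b::real_normed_vector) \<Rightarrow> 'a \<Rightarrow> 'b" where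
  "pderiv_dir e g y = frechet_derivative g (at y) e"

definition smooth_map :: "('a::euclidean_space \<Rightarrow> 'b::real_normed_vector) \<Rightarrow> bool" where
  "smooth_map f \<longleftrightarrow> (\<forall>es. set es \<subseteq> Basis \<longrightarrow> foldr pderiv_dir es f differentiable_on UNIV)"

definition immersion :: "('a::euclidean_space \<Rightarrow> 'b::real_normed_vector) \<Rightarrow> bool" where
  "immersion f \<longleftrightarrow> (\<exists>f'. (\<forall>y. (f has_derivative blinfun_apply (f' y)) (at y)) \<and>
      continuous_on UNIV f' \<and> (\<forall>y. inj (blinfun_apply (f' y))))"

definition Hx :: "(real^'n \<Rightarrow> real^'n \<Rightarrow> real) \<Rightarrow> real^'n \<Rightarrow> real^'n \<Rightarrow> real^'n" where
  "Hx H x p = (THE g. ((\<lambda>y. H y p) has_derivative (\<lambda>k. g \<bullet> k)) (at x))"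

definition Hp :: "(real^'n \<Rightarrow> real^'n \<Rightarrow> real) \<Rightarrow> real^'n \<Rightarrow> real^'n \<Rightarrow> real^'n" where
  "Hp H x p = (THE g. ((\<lambda>q. H x q) has_derivative (\<lambda>k. g \<bullet> k)) (at p))"

definition Hpp :: "(real^'n \<Rightarrow> real^'n \<Rightarrow> real) \<Rightarrow> real^'n \<Rightarrow> real^'n \<Rightarrow> real^'n \<Rightarrow> real^'n" where
  "Hpp H x p = (THE L. ((\<lambda>q. Hp H x q) has_derivative L) (at p))"

definition tonelli :: "(real^'n \<Rightarrow> real^'n \<Rightarrow> real) \<Rightarrow> bool" where
  "tonelli H \<longleftrightarrow>
     C2_fun (\<lambda>z. H (fst z) (snd z)) \<and>
     (\<forall>p. periodic_fun (\<lambda>x. H x p)) \<and>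
     (\<forall>x p v. v \<noteq> 0 \<longrightarrow> Hpp H x p v \<bullet> v > 0) \<and>
     (\<forall>M. \<exists>R. \<forall>x p. norm p \<ge> R \<longrightarrow> H x p \<ge> M * norm p)"

definition ham_traj :: "(real^'n \<Rightarrow> real^'n \<Rightarrow> real) \<Rightarrow> (real \<Rightarrow> (real^'n) \<times> (real^'n)) \<Rightarrow> bool" where
  "ham_traj H \<gamma> \<longleftrightarrow> (\<forall>s. (\<gamma> has_vector_derivative
      (Hp H (fst (\<gamma> s)) (snd (\<gamma> s)), - Hx H (fst (\<gamma> s)) (snd (\<gamma> s)))) (at s))"

definition ham_flow :: "(real^'n \<Rightarrow> real^'n \<Rightarrow> real) \<Rightarrow> real \<Rightarrow> (real^'n) \<times> (real^'n) \<Rightarrow> (real^'n) \<times> (real^'n)" where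
  "ham_flow H s z = (THE \<gamma>. ham_traj H \<gamma> \<and> \<gamma> 0 = z) s"

definition C1_test :: "(real^'n \<Rightarrow> real) \<Rightarrow> (real^'n \<Rightarrow> real^'n) \<Rightarrow> bool" where
  "C1_test \<phi> D\<phi> \<longleftrightarrow> continuous_on UNIV D\<phi> \<and> (\<forall>y. (\<phi> has_derivative (\<lambda>k. D\<phi> y \<bullet> k)) (at y))"

definition viscosity_solution ::
  "(real^'n \<Rightarrow> real \<Rightarrow> real^'n \<Rightarrow> real) \<Rightarrow> (real^'n \<Rightarrow> real) \<Rightarrow> bool" where
  "viscosity_solution F u \<longleftrightarrow>
     continuous_on UNIV u \<and> periodic_fun u \<and>
     (\<forall>\<phi> D\<phi> x. C1_test \<phi> D\<phi> \<and> (\<exists>r>0. \<forall>y\<in>ball x r. u y - \<phi> y \<le> u x - \<phi> x)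
         \<longrightarrow> F x (u x) (D\<phi> x) \<le> 0) \<and>
     (\<forall>\<phi> D\<phi> x. C1_test \<phi> D\<phi> \<and> (\<exists>r>0. \<forall>y\<in>ball x r. u y - \<phi> y \<ge> u x - \<phi> x)
         \<longrightarrow> F x (u x) (D\<phi> x) \<ge> 0)"

definition graph_c :: "real^'n \<Rightarrow> (real^'n \<Rightarrow> real) \<Rightarrow> ((real^'n) \<times> (real^'n)) set" where
  "graph_c c v = {(x, c + g) | x g. (v has_derivative (\<lambda>k. g \<bullet> k)) (at x)}"

text \<open>(a, b) are lifts of an embedding T^n -> T^n x R^n with image S (S periodic in x).\<close>

definition torus_embedding ::
  "(real^'n \<Rightarrow> real^'n) \<Rightarrow> (real^'n \<Rightarrow> real^'n) \<Rightarrow> ((real^'n) \<times> (real^'n)) set \<Rightarrow> bool" where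
  "torus_embedding a b S \<longleftrightarrow>
     (\<forall>\<theta> k. int_vec k \<longrightarrow> int_vec (a (\<theta> + k) - a \<theta>) \<and> b (\<theta> + k) = b \<theta>) \<and>
     (\<forall>\<theta> \<theta>'. tor_eq (a \<theta>) (a \<theta>') \<and> b \<theta> = b \<theta>' \<longrightarrow> tor_eq \<theta> \<theta>') \<and>
     immersion (\<lambda>\<theta>. (a \<theta>, b \<theta>)) \<and>
     (\<forall>\<theta>. (a \<theta>, b \<theta>) \<in> S) \<and>
     (\<forall>x p. (x, p) \<in> S \<longrightarrow> (\<exists>\<theta>. tor_eq x (a \<theta>) \<and> p = b \<theta>))"

definition diophantine :: "real \<Rightarrow> real \<Rightarrow> real^'n \<Rightarrow> bool" where
  "diophantine \<nu> \<eta> \<omega> \<longleftrightarrow> \<nu> > 0 \<and> \<eta> > real CARD('n) - 1 \<and>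
     (\<forall>z. int_vec z \<and> z \<noteq> 0 \<longrightarrow> \<bar>\<omega> \<bullet> z\<bar> \<ge> \<nu> * (\<Sum>i\<in>UNIV. \<bar>z $ i\<bar>) powr (- \<eta>))"

definition KAM_torus ::
  "(real^'n \<Rightarrow> real^'n \<Rightarrow> real) \<Rightarrow> real^'n \<Rightarrow> (real^'n \<Rightarrow> real) \<Rightarrow> real \<Rightarrow> real \<Rightarrow> real^'n \<Rightarrow> bool" where
  "KAM_torus H c v \<nu> \<eta> \<omega> \<longleftrightarrow>
     diophantine \<nu> \<eta> \<omega> \<and>
     \<comment> \<open>graph(c+v_x) is a smooth torus\<close>
     (\<exists>a b. smooth_map a \<and> smooth_map b \<and> torus_embedding a b (graph_c c v)) \<and>
     \<comment> \<open>invariant under the Hamiltonian flow\<close>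
     (\<forall>z\<in>graph_c c v. \<forall>s. ham_flow H s z \<in> graph_c c v) \<and>
     \<comment> \<open>C^1 parametrisation conjugating the flow to the linear flow with frequency omega\<close>
     (\<exists>\<phi> \<psi>. C1_map \<phi> \<and> C1_map \<psi> \<and> torus_embedding \<phi> \<psi> (graph_c c v) \<and>
        (\<forall>z\<in>graph_c c v. \<exists>\<theta>0. \<forall>s.
            tor_eq (fst (ham_flow H s z)) (\<phi> (s *\<^sub>R \<omega> + \<theta>0)) \<and>
            snd (ham_flow H s z) = \<psi> (s *\<^sub>R \<omega> + \<theta>0)))"

end

theory Submission
  imports Defs
begin

text \<open>Since the graph of \<open>c + v\<^sub>x\<close> is a torus, invariance of domain shows that \<open>v\<close> is \<open>C\<^sup>1\<close>. Testing
  with \<open>v\<close> itself bounds \<open>v\<^sup>\<epsilon>\<close> by the oscillation of \<open>v\<close>, and coercivity makes \<open>v\<^sup>\<epsilon>\<close> Lipschitz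
  uniformly in \<open>\<epsilon>\<close>. By convexity of \<open>H\<close> in \<open>p\<close>, the difference \<open>w = v\<^sup>\<epsilon> - v\<close> grows at rate at most
  \<open>O(\<epsilon>)\<close> along the characteristics of \<open>v\<close>, which are conjugate to the linear flow with frequency
  \<open>\<omega>\<close>. A Fourier argument shows that orbits of this flow of length \<open>O(\<delta>\<^bsup>-2\<eta>\<^esup>)\<close> are \<open>\<delta>\<close>-dense, so
  the oscillation of \<open>w\<close> is \<open>O(\<delta> + \<epsilon> \<delta>\<^bsup>-2\<eta>\<^esup>)\<close>, and \<open>\<delta> = \<epsilon>\<^bsup>1/(1+2\<eta>)\<^esup>\<close> balances the two terms.\<close>

section \<open>Globally Lipschitz differential equations\<close>

text \<open>\<open>ham_flow\<close> is a definite description, so nothing can be said about orbits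
  before global existence and uniqueness of trajectories are proved; the ODE part serves this
  purpose. For \<open>w\<close>, an upper bound on its growth along orbits suffices: the orbit from
  any x passes near any y, so it bounds w(y) - w(x), and x and y may be exchanged. The rate
  \<epsilon> comes from the uniform bound |u| <= K for the discounted solution u, which makes u a
  subsolution with right-hand side h(c) + \<epsilon> K. The obstacle there is that u is only
  Lipschitz and may fail to be differentiable along a whole orbit; a sup-convolution supplies
  quadratics that touch u at nearby points. The exponent 2\<eta> arises as follows: for integer
  frequencies up to N the divisors are at least of order N^(-\<eta>), so one average over a time
  window of order N^(2\<eta>) multiplies each nonconstant coefficient by a factor of order
  N^(-\<eta>). A number of averages depending only on n and \<eta> then beats the polynomial size of
  the Fourier data, and the total time stays of order N^(2\<eta>).\<close>

lemma exp_weight_integral: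
  fixes L s :: real
  assumes "L > 0" "0 \<le> s"
  shows "((\<lambda>t. exp (2 * L * t)) has_integral (exp (2 * L * s) - 1) / (2 * L)) {0..s}"
proof -
  have "((\<lambda>t. exp (2 * L * t)) has_integral
      exp (2 * L * s) / (2 * L) - exp (2 * L * 0) / (2 * L)) {0..s}"
    using assms
    by (intro fundamental_theorem_of_calculus)
       (auto intro!: derivative_eq_intros simp: has_real_derivative_iff_has_vector_derivative[symmetric])
  thus ?thesis by (simp add: diff_divide_distrib)
qed

text \<open>Picard iteration is a contraction in the norm \<open>sup\<^sub>s exp (-2Ls) \<bar>\<gamma> s\<bar>\<close>, so a single
  application of Banach's theorem gives the solution for all forward times.\<close>

lemma lipschitz_ode_forward:
  fixes F :: "'a::euclidean_space \<Rightarrow> 'a" and z :: 'a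
  assumes lip: "\<And>x y. norm (F x - F y) \<le> L * norm (x - y)" and L: "L > 0"
  obtains \<gamma> where "\<gamma> 0 = z"
    "\<And>s. 0 \<le> s \<Longrightarrow> (\<gamma> has_vector_derivative F (\<gamma> s)) (at s within {0..})"
proof -
  have contF: "continuous_on UNIV F"
    by (rule lipschitz_on_continuous_on[of L]) (use lip L in \<open>auto simp: lipschitz_on_def dist_norm\<close>)
  define I where "I \<beta> s = integral {0..s} (\<lambda>t. F (exp (2*L*t) *\<^sub>R \<beta> t))" for \<beta> :: "real \<Rightarrow> 'a" and s
  \<comment> \<open>The unknown is the weighted curve \<open>exp (-2Ls) \<gamma> s\<close>, which is
    bounded. Freezing time at \<open>max 0 s\<close> lets \<open>P\<close> act on bounded continuous
    functions on the whole line, a complete space.\<close>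
  define P where "P \<beta> s = exp (-2*L*max 0 s) *\<^sub>R (z + I \<beta> (max 0 s))" for \<beta> s
  have contI: "continuous_on UNIV (\<lambda>t. F (exp (2*L*t) *\<^sub>R \<beta> t))" if "continuous_on UNIV \<beta>" for \<beta> :: "real \<Rightarrow> 'a"
    by (rule continuous_on_compose2[OF contF]) (auto intro!: continuous_intros that)
  have integ: "(\<lambda>t. F (exp (2*L*t) *\<^sub>R \<beta> t)) integrable_on {a..b}" if "continuous_on UNIV \<beta>"
    for \<beta> :: "real \<Rightarrow> 'a" and a b
    using contI[OF that] by (intro integrable_continuous_interval) (auto intro: continuous_on_subset)
  have deriv: "((\<lambda>s. I \<beta> s) has_vector_derivative F (exp (2*L * s) *\<^sub>R \<beta> s)) (at s within {0..})"
    if "continuous_on UNIV \<beta>" "0 \<le> s" for \<beta> :: "real \<Rightarrow> 'a" and s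
  proof -
    have "((\<lambda>s. I \<beta> s) has_vector_derivative F (exp (2*L * s) *\<^sub>R \<beta> s)) (at s within {0..s+1})"
      unfolding I_def
      by (rule integral_has_vector_derivative)
         (use that contI[OF that(1)] in \<open>auto intro: continuous_on_subset\<close>)
    moreover have "at s within {0..s+1} = at s within {0..}"
      by (rule at_within_nhd[of s "{..<s+1}"]) auto
    ultimately show ?thesis by simp
  qed
  have contPI: "continuous_on UNIV (P \<beta>)" if "continuous_on UNIV \<beta>" for \<beta>
  proof -
    have "continuous_on {0..} (I \<beta>)"
      using deriv[OF that] by (intro continuous_on_vector_derivative) auto
    hence "continuous_on UNIV (\<lambda>s. I \<beta> (max 0 s))"
      by (rule continuous_on_compose2) (auto intro!: continuous_intros)
    thus ?thesis unfolding P_def by (intro continuous_intros)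
  qed
  have growth: "norm (F x) \<le> norm (F 0) + L * norm x" for x
    using lip[of x 0] norm_triangle_sub[of "F x" "F 0"] by simp
  have bd: "norm (P \<beta> s) \<le> norm z + (norm (F 0) + L * B) / (2*L)"
    if "continuous_on UNIV \<beta>" "\<And>t. norm (\<beta> t) \<le> B" for \<beta> B s
  proof -
    define r where "r = max 0 s"
    have r: "r \<ge> 0" by (simp add: r_def)
    have B: "B \<ge> 0" using that(2)[of 0] norm_ge_zero order_trans by blast
    have "norm (I \<beta> r) \<le> integral {0..r} (\<lambda>t. (norm (F 0) + L * B) * exp (2*L*t))"
      unfolding I_def
    proof (rule integral_norm_bound_integral)
      show "(\<lambda>t. (norm (F 0) + L * B) * exp (2*L*t)) integrable_on {0..r}"
        by (intro integrable_continuous_interval continuous_intros)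
      fix t assume t: "t \<in> {0..r}"
      have "norm (F (exp (2*L*t) *\<^sub>R \<beta> t)) \<le> norm (F 0) + L * (exp (2*L*t) * B)"
        using growth[of "exp (2*L*t) *\<^sub>R \<beta> t"] that(2)[of t] L
        by (smt (verit) exp_gt_zero mult_left_mono norm_scaleR)
      moreover have "norm (F 0) \<le> norm (F 0) * exp (2*L*t)"
        using t L mult_left_mono[of 1 "exp (2*L*t)" "norm (F 0)"] by simp
      ultimately show "norm (F (exp (2*L*t) *\<^sub>R \<beta> t)) \<le> (norm (F 0) + L * B) * exp (2*L*t)"
        by (simp add: algebra_simps)
    qed (use integ that in auto)
    also have "\<dots> = (norm (F 0) + L * B) * ((exp (2*L*r) - 1) / (2*L))"
      using exp_weight_integral[OF L r] by (simp add: integral_unique)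
    also have "\<dots> \<le> (norm (F 0) + L * B) * (exp (2*L*r) / (2*L))"
      using L B by (intro mult_left_mono divide_right_mono) auto
    finally have 1: "norm (I \<beta> r) \<le> (norm (F 0) + L * B) * (exp (2*L*r) / (2*L))" .
    have "norm (P \<beta> s) = exp (-2*L*r) * norm (z + I \<beta> r)"
      by (simp add: P_def r_def)
    also have "\<dots> \<le> exp (-2*L*r) * (norm z + (norm (F 0) + L * B) * (exp (2*L*r) / (2*L)))"
      using 1 norm_triangle_ineq[of z "I \<beta> r"] by (intro mult_left_mono) auto
    also have "\<dots> = exp (-2*L*r) * norm z + (norm (F 0) + L * B) / (2*L) * (exp (-2*L*r) * exp (2*L*r))"
      by (simp add: algebra_simps)
    also have "exp (-2*L*r) * exp (2*L*r) = 1" by (simp add: exp_minus)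
    also have "exp (-2*L*r) * norm z \<le> 1 * norm z" using L r by (intro mult_right_mono) auto
    finally show ?thesis by simp
  qed
  have Pbc: "P (apply_bcontfun \<beta>) \<in> bcontfun" for \<beta> :: "real \<Rightarrow>\<^sub>C 'a"
  proof (rule bcontfun_normI)
    show "continuous_on UNIV (P (apply_bcontfun \<beta>))" by (rule contPI) simp
    show "norm (P (apply_bcontfun \<beta>) s) \<le> norm z + (norm (F 0) + L * norm \<beta>) / (2*L)" for s
      by (rule bd) (auto intro: norm_bounded)
  qed
  define Q where "Q \<beta> = Bcontfun (P (apply_bcontfun \<beta>))" for \<beta> :: "real \<Rightarrow>\<^sub>C 'a"
  have Q: "apply_bcontfun (Q \<beta>) = P (apply_bcontfun \<beta>)" for \<beta>
    by (simp add: Q_def Bcontfun_inverse Pbc)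
  \<comment> \<open>Integrating the Lipschitz bound against the weight of rate \<open>2L\<close>
    gives the contraction factor L / (2L) = 1/2.\<close>
  have "dist (Q \<beta>1) (Q \<beta>2) \<le> 1/2 * dist \<beta>1 \<beta>2" for \<beta>1 \<beta>2
  proof (rule dist_bound)
    fix s :: real
    define r where "r = max 0 s"
    have r: "r \<ge> 0" by (simp add: r_def)
    define D where "D = dist \<beta>1 \<beta>2"
    let ?b1 = "apply_bcontfun \<beta>1" and ?b2 = "apply_bcontfun \<beta>2"
    have D: "norm (?b1 t - ?b2 t) \<le> D" for t
      using dist_bounded[of \<beta>1 t \<beta>2] by (simp add: dist_norm D_def)
    have c: "continuous_on UNIV ?b1" "continuous_on UNIV ?b2" by simp_all
    have "norm (I ?b1 r - I ?b2 r) = norm (integral {0..r} (\<lambda>t. F (exp (2*L*t) *\<^sub>R ?b1 t) - F (exp (2*L*t) *\<^sub>R ?b2 t)))"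
      unfolding I_def using integ c by (simp add: Henstock_Kurzweil_Integration.integral_diff)
    also have "\<dots> \<le> integral {0..r} (\<lambda>t. (L * D) * exp (2*L*t))"
    proof (rule integral_norm_bound_integral)
      show "(\<lambda>t. (L * D) * exp (2*L*t)) integrable_on {0..r}"
        by (intro integrable_continuous_interval continuous_intros)
      show "(\<lambda>t. F (exp (2*L*t) *\<^sub>R ?b1 t) - F (exp (2*L*t) *\<^sub>R ?b2 t)) integrable_on {0..r}"
        using integ c by (intro integrable_diff) auto
      fix t
      have "norm (F (exp (2*L*t) *\<^sub>R ?b1 t) - F (exp (2*L*t) *\<^sub>R ?b2 t))
          \<le> L * norm (exp (2*L*t) *\<^sub>R ?b1 t - exp (2*L*t) *\<^sub>R ?b2 t)" by (rule lip)
      also have "\<dots> = L * (exp (2*L*t) * norm (?b1 t - ?b2 t))"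
        by (simp flip: scaleR_diff_right)
      also have "\<dots> \<le> L * (exp (2*L*t) * D)" using D[of t] L by (intro mult_left_mono) auto
      finally show "norm (F (exp (2*L*t) *\<^sub>R ?b1 t) - F (exp (2*L*t) *\<^sub>R ?b2 t)) \<le> (L * D) * exp (2*L*t)"
        by (simp add: algebra_simps)
    qed
    also have "\<dots> = (L * D) * ((exp (2*L*r) - 1) / (2*L))"
      using exp_weight_integral[OF L r] by (simp add: integral_unique)
    also have "\<dots> \<le> (L * D) * (exp (2*L*r) / (2*L))"
      using L by (intro mult_left_mono divide_right_mono) (auto simp: D_def)
    also have "\<dots> = D/2 * exp (2*L*r)" using L by simp
    finally have 1: "norm (I ?b1 r - I ?b2 r) \<le> D/2 * exp (2*L*r)" .
    have "dist (Q \<beta>1 s) (Q \<beta>2 s) = exp (-2*L*r) * norm (I ?b1 r - I ?b2 r)"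
      by (simp add: Q P_def r_def dist_norm flip: scaleR_diff_right)
    also have "\<dots> \<le> exp (-2*L*r) * (D/2 * exp (2*L*r))" using 1 by (intro mult_left_mono) auto
    also have "\<dots> = D/2 * (exp (-2*L*r) * exp (2*L*r))" by simp
    also have "exp (-2*L*r) * exp (2*L*r) = 1" by (simp add: exp_minus)
    finally show "dist (Q \<beta>1 s) (Q \<beta>2 s) \<le> 1/2 * dist \<beta>1 \<beta>2" by (simp add: D_def)
  qed
  hence "\<exists>!\<beta>. Q \<beta> = \<beta>"
    by (intro banach_fix_type[where c = "1/2"]) auto
  then obtain \<beta> where \<beta>: "Q \<beta> = \<beta>" by auto
  define \<gamma> where "\<gamma> s = z + I (apply_bcontfun \<beta>) s" for s
  have \<gamma>: "\<gamma> s = exp (2*L * s) *\<^sub>R \<beta> s" if "s \<ge> 0" for s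
  proof -
    have "\<beta> s = exp (-2*L * s) *\<^sub>R \<gamma> s"
      using arg_cong[OF \<beta>, of "\<lambda>b. apply_bcontfun b s"] that by (simp add: Q P_def \<gamma>_def max_def)
    thus ?thesis by (simp add: exp_minus)
  qed
  show ?thesis
  proof
    show "\<gamma> 0 = z" by (simp add: \<gamma>_def I_def)
    show "(\<gamma> has_vector_derivative F (\<gamma> s)) (at s within {0..})" if "0 \<le> s" for s
      using deriv[of "apply_bcontfun \<beta>" s] that
      unfolding \<gamma>_def[abs_def] \<gamma>[OF that, unfolded \<gamma>_def]
      by (auto intro!: derivative_eq_intros)
  qed
qed

text \<open>Backward times come from the forward solution for \<open>-F\<close> run in reverse; at 0
  the two one-sided derivatives agree.\<close>

lemma lipschitz_ode_exists:
  fixes F :: "'a::euclidean_space \<Rightarrow> 'a" and z :: 'a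
  assumes lip: "\<And>x y. norm (F x - F y) \<le> L * norm (x - y)" and L: "L > 0"
  obtains \<gamma> where "\<gamma> 0 = z" "\<And>s. (\<gamma> has_vector_derivative F (\<gamma> s)) (at s)"
proof -
  obtain a where a: "a 0 = z"
    "\<And>s. 0 \<le> s \<Longrightarrow> (a has_vector_derivative F (a s)) (at s within {0..})"
    using lipschitz_ode_forward[OF lip L] by blast
  have "norm (- F x - - F y) \<le> L * norm (x - y)" for x y
    using lip[of x y] by (simp add: norm_minus_commute)
  then obtain b where b: "b 0 = z"
    "\<And>s. 0 \<le> s \<Longrightarrow> (b has_vector_derivative - F (b s)) (at s within {0..})"
    using lipschitz_ode_forward[of "\<lambda>x. - F x", OF _ L] by metis
  define b' where "b' s = b (- s)" for s
  have b': "(b' has_vector_derivative F (b' s)) (at s within {..0})" if "s \<le> 0" for s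
  proof -
    have "uminus ` {..0::real} = {0..}" by auto
    hence "(b has_vector_derivative - F (b (-s))) (at (-s) within uminus ` {..0})"
      using b(2)[of "-s"] that by simp
    hence "((b \<circ> uminus) has_vector_derivative (-1) *\<^sub>R - F (b (-s))) (at s within {..0})"
      by (intro vector_diff_chain_within) (auto intro!: derivative_eq_intros)
    thus ?thesis by (simp add: b'_def[abs_def] o_def)
  qed
  define \<gamma> where "\<gamma> s = (if s \<ge> 0 then a s else b' s)" for s
  have ge: "(\<gamma> has_vector_derivative F (\<gamma> s)) (at s within {0..})" if "s \<ge> 0" for s
    using that by (intro has_vector_derivative_transform[OF _ _ a(2)[THEN has_vector_derivative_eq_rhs]])
      (auto simp: \<gamma>_def)
  have le: "(\<gamma> has_vector_derivative F (\<gamma> s)) (at s within {..0})" if "s \<le> 0" for s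
    using that by (intro has_vector_derivative_transform[OF _ _ b'[THEN has_vector_derivative_eq_rhs]])
      (auto simp: \<gamma>_def a b b'_def)
  show ?thesis
  proof
    show "\<gamma> 0 = z" by (simp add: \<gamma>_def a)
    show "(\<gamma> has_vector_derivative F (\<gamma> s)) (at s)" for s
    proof (cases "s = 0")
      case True
      have "({0..} \<union> {..0::real}) = UNIV" by auto
      moreover have "(\<gamma> has_vector_derivative F (\<gamma> s)) (at s within {0..} \<union> {..0})"
        using ge[of s] le[of s] True unfolding has_vector_derivative_def has_derivative_within
        by (auto intro!: Lim_Un)
      ultimately show ?thesis by simp
    next
      case False
      show ?thesis
      proof (cases "s > 0")
        case True
        have "at s within {0..} = at s" using True by (intro at_within_interior) auto
        thus ?thesis using ge[of s] True by simp
      next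
        case f: False
        have "at s within {..0} = at s" using False f by (intro at_within_interior) auto
        thus ?thesis using le[of s] f by simp
      qed
    qed
  qed
qed

text \<open>Gronwall for the squared distance \<open>d\<close>, which satisfies |d'| <= 2 L d:
  \<open>d\<close> times a decaying exponential is monotone away from 0 in either time direction,
  and \<open>d 0 = 0\<close>.\<close>

lemma lipschitz_ode_unique:
  fixes F :: "'a::euclidean_space \<Rightarrow> 'a"
  assumes lip: "\<And>x y. norm (F x - F y) \<le> L * norm (x - y)"
    and a: "\<And>s. (a has_vector_derivative F (a s)) (at s)"
    and b: "\<And>s. (b has_vector_derivative F (b s)) (at s)"
    and eq: "a 0 = b 0"
  shows "a s = b s"
proof -
  define d where "d s = (a s - b s) \<bullet> (a s - b s)" for s
  define d' where "d' s = 2 * ((F (a s) - F (b s)) \<bullet> (a s - b s))" for s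
  have dd: "(d has_real_derivative d' s) (at s)" for s
  proof -
    have "((\<lambda>s. a s - b s) has_derivative (\<lambda>h. h *\<^sub>R (F (a s) - F (b s)))) (at s)"
      using has_vector_derivative_diff[OF a b] by (simp add: has_vector_derivative_def)
    from has_derivative_inner[OF this this]
    show ?thesis unfolding d_def[abs_def] d'_def has_field_derivative_def
      by (rule has_derivative_eq_rhs) (auto simp: inner_commute algebra_simps fun_eq_iff)
  qed
  have d': "\<bar>d' s\<bar> \<le> 2 * L * d s" for s
  proof -
    have "\<bar>(F (a s) - F (b s)) \<bullet> (a s - b s)\<bar> \<le> norm (F (a s) - F (b s)) * norm (a s - b s)"
      by (rule Cauchy_Schwarz_ineq2)
    also have "\<dots> \<le> (L * norm (a s - b s)) * norm (a s - b s)"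
      by (intro mult_right_mono lip) auto
    finally show ?thesis
      by (simp add: d'_def d_def abs_mult power2_norm_eq_inner[symmetric] power2_eq_square)
  qed
  have d0: "d 0 = 0" by (simp add: d_def eq)
  have "d s \<le> 0"
  proof (cases "s \<ge> 0")
    case True
    have "d s * exp (- (2 * L * s)) \<le> d 0 * exp (- (2 * L * 0))"
    proof (rule DERIV_nonpos_imp_nonincreasing[OF True], intro exI conjI)
      fix x
      show "((\<lambda>x. d x * exp (- (2 * L * x))) has_real_derivative
        (d' x - 2 * L * d x) * exp (- (2 * L * x))) (at x)"
        by (auto intro!: derivative_eq_intros dd simp: algebra_simps)
      show "(d' x - 2 * L * d x) * exp (- (2 * L * x)) \<le> 0"
        using d'[of x] by (intro mult_nonpos_nonneg) auto
    qed
    thus ?thesis by (simp add: d0 mult_le_0_iff)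
  next
    case False
    hence "s \<le> 0" by simp
    have "d s * exp (2 * L * s) \<le> d 0 * exp (2 * L * 0)"
    proof (rule DERIV_nonneg_imp_nondecreasing[OF \<open>s \<le> 0\<close>], intro exI conjI)
      fix x
      show "((\<lambda>x. d x * exp (2 * L * x)) has_real_derivative
        (d' x + 2 * L * d x) * exp (2 * L * x)) (at x)"
        by (auto intro!: derivative_eq_intros dd simp: algebra_simps)
      show "(d' x + 2 * L * d x) * exp (2 * L * x) \<ge> 0"
        using d'[of x] by (intro mult_nonneg_nonneg) auto
    qed
    thus ?thesis by (simp add: d0 mult_le_0_iff)
  qed
  hence "(a s - b s) \<bullet> (a s - b s) = 0"
    by (intro order_antisym) (auto simp: d_def)
  thus ?thesis by simp
qed

section \<open>Density of Diophantine linear orbits\<close>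

text \<open>Averaging \<open>m\<close> times over windows of length \<open>T\<close> multiplies the coefficient of frequency \<open>\<alpha>\<close>
  by a factor of size at most \<open>(2 / (\<bar>\<alpha>\<bar> T))\<^sup>m\<close> and preserves nonpositivity.\<close>

lemma nonpos_almost_periodic_mean_bound:
  fixes c :: "'i \<Rightarrow> complex" and \<alpha> :: "'i \<Rightarrow> real"
  assumes fin: "finite I" and T: "T > 0"
    and neg: "\<And>s. 0 \<le> s \<Longrightarrow> s \<le> real m * T \<Longrightarrow> Re (\<Sum>k\<in>I. c k * cis (\<alpha> k * s)) \<le> 0"
  shows "Re (\<Sum>k\<in>{k\<in>I. \<alpha> k = 0}. c k)
    \<le> (\<Sum>k\<in>{k\<in>I. \<alpha> k \<noteq> 0}. norm (c k) * (2 / (\<bar>\<alpha> k\<bar> * T)) ^ m)"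
  using neg
proof (induction m arbitrary: c)
  case 0
  have "Re (\<Sum>k\<in>I. c k) \<le> 0" using "0.prems"[of 0] by simp
  moreover have "(\<Sum>k\<in>I. c k) = (\<Sum>k\<in>{k\<in>I. \<alpha> k = 0}. c k) + (\<Sum>k\<in>{k\<in>I. \<alpha> k \<noteq> 0}. c k)"
    using fin by (subst sum.union_disjoint[symmetric]) (auto intro!: sum.cong)
  moreover have "- Re (\<Sum>k\<in>{k\<in>I. \<alpha> k \<noteq> 0}. c k) \<le> norm (\<Sum>k\<in>{k\<in>I. \<alpha> k \<noteq> 0}. c k)"
    using abs_Re_le_cmod abs_le_D2 by blast
  moreover have "\<dots> \<le> (\<Sum>k\<in>{k\<in>I. \<alpha> k \<noteq> 0}. norm (c k))" by (rule norm_sum)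
  ultimately show ?case by simp
next
  case (Suc m)
  define l where "l k = (if \<alpha> k = 0 then 1 else (cis (\<alpha> k * T) - 1) / (\<i> * \<alpha> k * T))" for k
  have int_cis: "((\<lambda>t. cis (a * (s + t))) has_integral
      (if a = 0 then of_real T else cis (a * s) * ((cis (a * T) - 1) / (\<i> * a)))) {0..T}" for a s
  proof (cases "a = 0")
    case True
    thus ?thesis using has_integral_const_real[of "1::complex" 0 T] T by (simp add: scaleR_conv_of_real)
  next
    case False
    have "((\<lambda>t. cis (a * (s + t))) has_integral
        cis (a * (s + T)) / (\<i> * a) - cis (a * (s + 0)) / (\<i> * a)) {0..T}"
    proof (rule fundamental_theorem_of_calculus)
      fix x assume "x \<in> {0..T}"
      show "((\<lambda>t. cis (a * (s + t)) / (\<i> * a)) has_vector_derivative cis (a * (s + x))) (at x within {0..T})"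
        using False unfolding has_vector_derivative_def
        by (auto intro!: derivative_eq_intros simp: fun_eq_iff scaleR_conv_of_real)
           (simp add: complex_eq_iff)
    qed (use T in auto)
    moreover have "cis (a * (s + T)) = cis (a * s) * cis (a * T)"
      by (simp add: cis_mult algebra_simps)
    ultimately show ?thesis using False by (simp add: diff_divide_distrib right_diff_distrib)
  qed
  have avg: "((\<lambda>t. c k * cis (\<alpha> k * (s + t))) has_integral T * (c k * l k * cis (\<alpha> k * s))) {0..T}" for k s
  proof -
    have "c k * (if \<alpha> k = 0 then of_real T else cis (\<alpha> k * s) * ((cis (\<alpha> k * T) - 1) / (\<i> * \<alpha> k)))
      = T * (c k * l k * cis (\<alpha> k * s))"
      using T by (auto simp: l_def)
    thus ?thesis using has_integral_mult_right[OF int_cis[of "\<alpha> k" s], of "c k"] by argo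
  qed
  have "Re (\<Sum>k\<in>{k\<in>I. \<alpha> k = 0}. c k * l k)
    \<le> (\<Sum>k\<in>{k\<in>I. \<alpha> k \<noteq> 0}. norm (c k * l k) * (2 / (\<bar>\<alpha> k\<bar> * T)) ^ m)"
  proof (rule Suc.IH)
    fix s assume s: "0 \<le> s" "s \<le> real m * T"
    have "((\<lambda>t. \<Sum>k\<in>I. c k * cis (\<alpha> k * (s + t))) has_integral
        (\<Sum>k\<in>I. T * (c k * l k * cis (\<alpha> k * s)))) {0..T}"
      by (intro has_integral_sum avg fin)
    hence "((\<lambda>t. Re (\<Sum>k\<in>I. c k * cis (\<alpha> k * (s + t)))) has_integral
        Re (\<Sum>k\<in>I. T * (c k * l k * cis (\<alpha> k * s)))) {0..T}"
      by (rule has_integral_Re)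
    moreover have "((\<lambda>t. 0) has_integral (0::real)) {0..T}" by simp
    \<comment> \<open>Each average spends one window of time: for \<open>s\<close> within the first
      \<open>m\<close> windows, \<open>s + t\<close> stays within the \<open>Suc m\<close> windows
      where the sign is known.\<close>
    moreover have "Re (\<Sum>k\<in>I. c k * cis (\<alpha> k * (s + t))) \<le> 0" if "t \<in> {0..T}" for t
      using s that T by (intro Suc.prems) (auto simp: algebra_simps)
    ultimately have "Re (\<Sum>k\<in>I. T * (c k * l k * cis (\<alpha> k * s))) \<le> 0"
      by (rule has_integral_le)
    also have "(\<Sum>k\<in>I. T * (c k * l k * cis (\<alpha> k * s))) = T * (\<Sum>k\<in>I. (c k * l k * cis (\<alpha> k * s)))"
      by (simp add: sum_distrib_left)
    finally show "Re (\<Sum>k\<in>I. c k * l k * cis (\<alpha> k * s)) \<le> 0"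
      using T by (simp add: mult_le_0_iff)
  qed
  also have "(\<Sum>k\<in>{k\<in>I. \<alpha> k = 0}. c k * l k) = (\<Sum>k\<in>{k\<in>I. \<alpha> k = 0}. c k)"
    by (intro sum.cong) (auto simp: l_def)
  also have "(\<Sum>k\<in>{k\<in>I. \<alpha> k \<noteq> 0}. norm (c k * l k) * (2 / (\<bar>\<alpha> k\<bar> * T)) ^ m)
    \<le> (\<Sum>k\<in>{k\<in>I. \<alpha> k \<noteq> 0}. norm (c k) * (2 / (\<bar>\<alpha> k\<bar> * T)) ^ Suc m)"
  proof (rule sum_mono)
    fix k assume k: "k \<in> {k\<in>I. \<alpha> k \<noteq> 0}"
    have "norm (cis (\<alpha> k * T) - 1) \<le> 2"
      using norm_triangle_ineq4[of "cis (\<alpha> k * T)" 1] by simp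
    hence "norm (l k) \<le> 2 / (\<bar>\<alpha> k\<bar> * T)"
      using k T by (simp add: l_def norm_divide norm_mult divide_right_mono)
    hence "norm (c k) * norm (l k) * (2 / (\<bar>\<alpha> k\<bar> * T)) ^ m
      \<le> norm (c k) * (2 / (\<bar>\<alpha> k\<bar> * T)) * (2 / (\<bar>\<alpha> k\<bar> * T)) ^ m"
      using T by (intro mult_right_mono mult_left_mono) auto
    thus "norm (c k * l k) * (2 / (\<bar>\<alpha> k\<bar> * T)) ^ m \<le> norm (c k) * (2 / (\<bar>\<alpha> k\<bar> * T)) ^ Suc m"
      by (simp add: norm_mult mult_ac)
  qed
  finally show ?case .
qed

section \<open>One-variable trigonometric kernels\<close>

text \<open>\<open>z\<close> is the mean over a period and \<open>M\<close> a common coefficient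
  bound: the averaging argument plays the mean against the nonconstant coefficients, whose
  frequencies are limited by \<open>N\<close>.\<close>

definition trig_poly :: "nat \<Rightarrow> real \<Rightarrow> complex \<Rightarrow> (real \<Rightarrow> real) \<Rightarrow> bool" where
  "trig_poly N M z f \<longleftrightarrow> (\<exists>c. c 0 = z \<and> (\<forall>d. norm (c d) \<le> M) \<and>
     (\<forall>t. complex_of_real (f t) = (\<Sum>d\<in>{- int N..int N}. c d * cis (2 * pi * of_int d * t))))"

text \<open>Indices that share a frequency are collected into one coefficient, as is required for
  the differences j - l in a squared modulus. The l1 bound on \<open>b\<close> survives this
  grouping.\<close>

lemma trig_polyI:
  fixes b :: "'i \<Rightarrow> complex" and w :: "'i \<Rightarrow> int"
  assumes fin: "finite I" and w: "\<And>i. i \<in> I \<Longrightarrow> \<bar>w i\<bar> \<le> int N"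
    and f: "\<And>t. complex_of_real (f t) = (\<Sum>i\<in>I. b i * cis (2 * pi * of_int (w i) * t))"
    and M: "(\<Sum>i\<in>I. norm (b i)) \<le> M"
    and z: "(\<Sum>i\<in>{i\<in>I. w i = 0}. b i) = z"
  shows "trig_poly N M z f"
  unfolding trig_poly_def
proof (intro exI conjI allI)
  let ?c = "\<lambda>d. \<Sum>i\<in>{i\<in>I. w i = d}. b i"
  show "?c 0 = z" by (rule z)
  show "norm (?c d) \<le> M" for d
  proof -
    have "norm (?c d) \<le> (\<Sum>i\<in>{i\<in>I. w i = d}. norm (b i))" by (rule norm_sum)
    also have "\<dots> \<le> (\<Sum>i\<in>I. norm (b i))" using fin by (intro sum_mono2) auto
    finally show ?thesis using M by simp
  qed
  fix t
  have "(\<Sum>d\<in>{- int N..int N}. \<Sum>i\<in>{i\<in>I. w i = d}. b i * cis (2 * pi * of_int (w i) * t))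
    = (\<Sum>i\<in>I. b i * cis (2 * pi * of_int (w i) * t))"
    using w by (intro sum.group fin) (auto simp: abs_le_iff minus_le_iff)
  thus "complex_of_real (f t) = (\<Sum>d\<in>{- int N..int N}. ?c d * cis (2 * pi * of_int d * t))"
    by (simp add: f sum_distrib_right)
qed

lemma cis_sum: "finite A \<Longrightarrow> cis (\<Sum>j\<in>A. a j) = (\<Prod>j\<in>A. cis (a j))"
  by (induction A rule: finite_induct) (auto simp: cis_mult[symmetric])

text \<open>Jordan's inequality (concavity of sine) squared, through 1 - cos(2 pi r) = 2 sin(pi
  r)^2. It later turns a small cosine defect into closeness to an integer.\<close>

lemma one_minus_cos_ge:
  fixes r :: real
  assumes "\<bar>r\<bar> \<le> 1/2"
  shows "8 * r\<^sup>2 \<le> 1 - cos (2 * pi * r)"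
proof -
  have cv: "convex_on {0..pi} (\<lambda>x. - sin x)"
    by (rule f''_ge0_imp_convex[where f' = "\<lambda>x. - cos x" and f'' = sin])
       (auto intro!: derivative_eq_intros sin_ge_zero)
  have jordan: "2 * t \<le> sin (pi * t)" if "0 \<le> t" "t \<le> 1/2" for t :: real
    using convex_onD[OF cv, of "2*t" 0 "pi/2"] that by (simp add: algebra_simps)
  have "2 * \<bar>r\<bar> \<le> \<bar>sin (pi * r)\<bar>"
    using jordan[of "\<bar>r\<bar>"] assms by (cases "r \<ge> 0") auto
  hence "(2 * \<bar>r\<bar>)\<^sup>2 \<le> \<bar>sin (pi * r)\<bar>\<^sup>2" by (intro power_mono) auto
  hence "4 * r\<^sup>2 \<le> (sin (pi * r))\<^sup>2" by (simp add: power_mult_distrib)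
  moreover have "cos (2 * (pi * r)) = 1 - 2 * (sin (pi * r))\<^sup>2" by (rule cos_double_sin)
  ultimately show ?thesis by (simp add: mult.assoc)
qed

lemma one_minus_cos_le:
  fixes x :: real
  shows "1 - cos x \<le> x\<^sup>2 / 2"
proof -
  have "(sin (x/2))\<^sup>2 \<le> (x/2)\<^sup>2"
    using abs_sin_x_le_abs_x[of "x/2"] by (simp only: abs_le_square_iff)
  moreover have "cos (2 * (x/2)) = 1 - 2 * (sin (x/2))\<^sup>2" by (rule cos_double_sin)
  ultimately show ?thesis by (simp add: power2_eq_square)
qed

text \<open>The Fejer-type kernel whose coefficients are the first Dirichlet eigenvector of the path of
  length \<open>N\<close>: it is concentrated at scale \<open>1/N\<close>, in the sense that multiplying it by
  \<open>cos - 1 + O(N\<^sup>-\<^sup>2)\<close> keeps a positive mean.\<close>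

lemma concentrated_kernel:
  assumes N: "N \<ge> 2"
  obtains k q :: "real \<Rightarrow> real" and q0 :: real where
    "trig_poly N (3 * real N ^ 2) 1 k" "trig_poly N (3 * real N ^ 2) (of_real q0) q"
    "q0 \<ge> 1 / real N ^ 2" "\<And>t. k t \<ge> 0"
    "\<And>t. q t = k t * (cos (2 * pi * t) - 1 + 9 / real N ^ 2)"
proof -
  \<comment> \<open>Interior vertices of the path 0, ..., N; the sine vector vanishes at both
    ends.\<close>
  define J where "J = {1..int N - 1}"
  have finJ: "finite J" by (simp add: J_def)
  define S where "S = (\<Sum>j\<in>J. (sin (pi * j / N))\<^sup>2)"
  define a where "a j = sin (pi * of_int j / N) / sqrt S" for j :: int
  have "0 < (sin (pi * (1::int) / N))\<^sup>2"
    using N by (intro zero_less_power sin_gt_zero) (auto simp: field_simps)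
  also have "\<dots> \<le> S" unfolding S_def
    by (rule member_le_sum) (use N finJ in \<open>auto simp: J_def\<close>)
  finally have S: "S > 0" .
  have a1: "(\<Sum>j\<in>J. (a j)\<^sup>2) = 1"
    using S by (simp add: a_def power_divide S_def[symmetric] sum_divide_distrib[symmetric])
  have aJ: "\<bar>a j\<bar> \<le> 1" if "j \<in> J" for j
  proof -
    have "(a j)\<^sup>2 \<le> 1" unfolding a1[symmetric] by (rule member_le_sum) (use that finJ in auto)
    thus ?thesis by (simp add: abs_square_le_1)
  qed
  have a0: "a 0 = 0" "a (int N) = 0" using N by (auto simp: a_def)
  \<comment> \<open>Eigenvector relation for the adjacency operator of the path; cos(pi/N) is within
    order 1/N^2 of 1, which is what makes the kernel concentrated at scale 1/N.\<close>
  have eig: "a (j + 1) + a (j - 1) = 2 * cos (pi / N) * a j" for j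
  proof -
    have "sin (pi * (j+1) / N) = sin (pi * j / N + pi / N)" "sin (pi * (j-1) / N) = sin (pi * j / N - pi / N)"
      by (auto simp: algebra_simps add_divide_distrib diff_divide_distrib)
    hence "sin (pi * (j+1) / N) + sin (pi * (j-1) / N) = 2 * cos (pi / N) * sin (pi * j / N)"
      by (simp only: sin_add sin_diff) (simp add: algebra_simps)
    moreover have "a (j + 1) + a (j - 1) = (sin (pi * (j+1) / N) + sin (pi * (j-1) / N)) / sqrt S"
      by (simp add: a_def add_divide_distrib)
    ultimately show ?thesis by (simp add: a_def)
  qed
  define F where "F t = (\<Sum>j\<in>J. a j * cis (2 * pi * j * t))" for t
  define k where "k t = (norm (F t))\<^sup>2" for t
  define e where "e = 9 / real N ^ 2 - 1"
  define q where "q t = k t * (cos (2 * pi * t) - 1 + 9 / real N ^ 2)" for t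
  have cardJ: "real (card (J \<times> J)) \<le> real N ^ 2"
    using N by (simp add: J_def card_cartesian_product power2_eq_square nat_diff_distrib' of_nat_diff mult_mono)
  have kexp: "complex_of_real (k t) = (\<Sum>(j,l)\<in>J\<times>J. of_real (a j * a l) * cis (2 * pi * of_int (j - l) * t))" for t
  proof -
    have "complex_of_real (k t) = F t * cnj (F t)" by (simp only: k_def complex_norm_square)
    also have "\<dots> = (\<Sum>j\<in>J. \<Sum>l\<in>J. (a j * cis (2 * pi * j * t)) * cnj (a l * cis (2 * pi * l * t)))"
      by (simp add: F_def cnj_sum sum_product)
    also have "\<dots> = (\<Sum>j\<in>J. \<Sum>l\<in>J. of_real (a j * a l) * cis (2 * pi * of_int (j - l) * t))"
    proof (intro sum.cong refl)
      fix j l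
      have "cis (2 * pi * of_int (j - l) * t) = cis (2 * pi * j * t) * cis (- (2 * pi * l * t))"
        by (simp add: cis_mult algebra_simps)
      thus "(a j * cis (2 * pi * j * t)) * cnj (a l * cis (2 * pi * l * t))
        = of_real (a j * a l) * cis (2 * pi * of_int (j - l) * t)"
        by (simp add: cis_cnj)
    qed
    finally show ?thesis by (simp add: sum.cartesian_product)
  qed
  have "trig_poly N (3 * real N ^ 2) 1 k"
  proof (rule trig_polyI[where I = "J \<times> J" and b = "\<lambda>(j,l). of_real (a j * a l)" and w = "\<lambda>(j,l). j - l"])
    show "complex_of_real (k t) = (\<Sum>i\<in>J \<times> J. (case i of (j, l) \<Rightarrow> of_real (a j * a l)) *
        cis (2 * pi * of_int (case i of (j, l) \<Rightarrow> j - l) * t))" for t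
      by (simp add: kexp case_prod_beta)
    have "(\<Sum>i\<in>J \<times> J. norm (case i of (j, l) \<Rightarrow> complex_of_real (a j * a l))) \<le> (\<Sum>i\<in>J \<times> J. 1)"
      using aJ by (intro sum_mono) (auto simp: norm_mult mult_le_one)
    also have "\<dots> \<le> real N ^ 2" using cardJ by simp
    finally show "(\<Sum>i\<in>J \<times> J. norm (case i of (j, l) \<Rightarrow> complex_of_real (a j * a l))) \<le> 3 * real N ^ 2"
      by (smt (verit) zero_le_power2)
    have "(\<Sum>i\<in>{i\<in>J \<times> J. (case i of (j, l) \<Rightarrow> j - l) = 0}. (case i of (j, l) \<Rightarrow> of_real (a j * a l)))
      = (\<Sum>j\<in>J. complex_of_real ((a j)\<^sup>2))"
      by (rule sum.reindex_bij_witness[where i = "\<lambda>j. (j,j)" and j = fst]) (auto simp: power2_eq_square)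
    thus "(\<Sum>i\<in>{i\<in>J \<times> J. (case i of (j, l) \<Rightarrow> j - l) = 0}. (case i of (j, l) \<Rightarrow> of_real (a j * a l))) = (1::complex)"
      using a1 by (metis of_real_1 of_real_sum)
  qed (auto simp: J_def)
  \<comment> \<open>Fourier coefficients of the multiplier \<open>e + cos (2 pi t)\<close> at the
    frequencies -1, 0 and 1.\<close>
  moreover define b where "b s = (if s = 0 then e else 1/2)" for s :: int
  define q0 where "q0 = (\<Sum>j\<in>J. (a j)\<^sup>2 * (e + cos (pi / N)))"
  have "trig_poly N (3 * real N ^ 2) (of_real q0) q"
  proof (rule trig_polyI[where I = "{-1,0,1} \<times> (J \<times> J)" and b = "\<lambda>(s,j,l). of_real (b s * (a j * a l))"
        and w = "\<lambda>(s,j,l). s + (j - l)"])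
    show "complex_of_real (q t) = (\<Sum>i\<in>{-1,0,1} \<times> J \<times> J. (case i of (s, j, l) \<Rightarrow> of_real (b s * (a j * a l))) *
        cis (2 * pi * of_int (case i of (s, j, l) \<Rightarrow> s + (j - l)) * t))" for t
    proof -
      have "(\<Sum>i\<in>{-1,0,1} \<times> J \<times> J. (case i of (s, j, l) \<Rightarrow> complex_of_real (b s * (a j * a l))) *
          cis (2 * pi * of_int (case i of (s, j, l) \<Rightarrow> s + (j - l)) * t))
        = (\<Sum>s\<in>{-1,0,1}. \<Sum>(j,l)\<in>J\<times>J. (of_real (b s) * cis (2 * pi * of_int s * t)) *
            (of_real (a j * a l) * cis (2 * pi * of_int (j - l) * t)))"
        unfolding sum.cartesian_product
        by (rule sum.cong) (auto simp: algebra_simps cis_mult)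
      also have "\<dots> = (\<Sum>s\<in>{-1,0,1}. of_real (b s) * cis (2 * pi * of_int s * t)) * of_real (k t)"
        unfolding kexp sum_product by (intro sum.cong refl) (auto simp: case_prod_beta)
      also have "(\<Sum>s\<in>{-1,0,1}. of_real (b s) * cis (2 * pi * of_int s * t)) = complex_of_real (e + cos (2 * pi * t))"
        by (auto simp: b_def complex_eq_iff)
      finally show ?thesis by (simp add: q_def e_def algebra_simps)
    qed
    have eb: "\<bar>e\<bar> \<le> 2"
    proof -
      have "(4::real) \<le> real N ^ 2" using power_mono[of 2 "real N" 2] N by simp
      hence "9 / real N ^ 2 \<le> 9 / 4" using N by (intro divide_left_mono) auto
      moreover have "0 \<le> 9 / real N ^ 2" by simp
      ultimately show ?thesis unfolding e_def abs_le_iff by linarith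
    qed
    have "(\<Sum>i\<in>{-1,0,1} \<times> J \<times> J. norm (case i of (s, j, l) \<Rightarrow> complex_of_real (b s * (a j * a l))))
      = (\<Sum>s\<in>{-1,0,1}. \<Sum>(j,l)\<in>J\<times>J. \<bar>b s\<bar> * \<bar>a j * a l\<bar>)"
      unfolding sum.cartesian_product by (rule sum.cong) (auto simp: abs_mult norm_mult)
    also have "\<dots> \<le> (\<Sum>s\<in>{-1,0,1}. \<Sum>(j,l)\<in>J\<times>J. \<bar>b s\<bar>)"
      using aJ by (intro sum_mono) (auto simp: abs_mult intro!: mult_left_le mult_le_one)
    also have "\<dots> = (1 + \<bar>e\<bar>) * card (J \<times> J)"
      by (auto simp: b_def case_prod_beta algebra_simps)
    also have "\<dots> \<le> 3 * real N ^ 2"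
      using eb cardJ by (intro mult_mono) auto
    finally show "(\<Sum>i\<in>{-1,0,1} \<times> J \<times> J. norm (case i of (s, j, l) \<Rightarrow> complex_of_real (b s * (a j * a l)))) \<le> 3 * real N ^ 2" .
    let ?I = "{-1,0,1::int} \<times> J \<times> J"
    have "(\<Sum>i\<in>{i\<in>?I. (case i of (s, j, l) \<Rightarrow> s + (j - l)) = 0}. (case i of (s, j, l) \<Rightarrow> b s * (a j * a l)))
      = (\<Sum>i\<in>?I. if (case i of (s, j, l) \<Rightarrow> s + (j - l)) = 0 then (case i of (s, j, l) \<Rightarrow> b s * (a j * a l)) else 0)"
      using finJ by (intro sum.inter_filter) auto
    also have "\<dots> = (\<Sum>s\<in>{-1,0,1}. \<Sum>j\<in>J. \<Sum>l\<in>J. if l = s + j then b s * (a j * a l) else 0)"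
      unfolding sum.cartesian_product by (intro sum.cong) auto
    also have "\<dots> = (\<Sum>s\<in>{-1,0,1}. \<Sum>j\<in>J. b s * (a j * a (s + j)))"
    proof (intro sum.cong refl)
      fix s j :: int assume "s \<in> {-1,0,1}" "j \<in> J"
      \<comment> \<open>A shift by one leaves \<open>J\<close> only at 0 or \<open>N\<close>, where
        \<open>a\<close> vanishes, so no boundary term is lost.\<close>
      hence "s + j \<in> J \<or> s + j = 0 \<or> s + j = int N" unfolding J_def by auto
      thus "(\<Sum>l\<in>J. if l = s + j then b s * (a j * a l) else 0) = b s * (a j * a (s + j))"
        using finJ a0 by (auto simp: sum.delta)
    qed
    also have "\<dots> = (\<Sum>j\<in>J. a j * (e * a j + (a (j + 1) + a (j - 1)) / 2))"
      by (simp add: b_def sum.distrib[symmetric] algebra_simps add_divide_distrib)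
    also have "\<dots> = q0"
      unfolding q0_def eig by (intro sum.cong refl) (simp add: algebra_simps power2_eq_square)
    finally have "(\<Sum>i\<in>{i\<in>?I. (case i of (s, j, l) \<Rightarrow> s + (j - l)) = 0}. (case i of (s, j, l) \<Rightarrow> b s * (a j * a l))) = q0" .
    hence "complex_of_real (\<Sum>i\<in>{i\<in>?I. (case i of (s, j, l) \<Rightarrow> s + (j - l)) = 0}. (case i of (s, j, l) \<Rightarrow> b s * (a j * a l))) = of_real q0"
      by simp
    thus "(\<Sum>i\<in>{i\<in>?I. (case i of (s, j, l) \<Rightarrow> s + (j - l)) = 0}. (case i of (s, j, l) \<Rightarrow> of_real (b s * (a j * a l)))) = complex_of_real q0"
      by (simp add: case_prod_beta)
  qed (auto simp: J_def)
  moreover have "q0 \<ge> 1 / real N ^ 2"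
  proof -
    \<comment> \<open>Since pi < 4, the defect 1 - cos(pi/N) is at most 8/N^2. The constant 9 in the
      multiplier therefore leaves a mean of at least 1/N^2.\<close>
    have "q0 = e + cos (pi / N)" using a1 by (simp add: q0_def sum_distrib_right[symmetric])
    moreover have "1 - cos (pi / N) \<le> (pi / N)\<^sup>2 / 2" by (rule one_minus_cos_le)
    moreover have "(pi / N)\<^sup>2 / 2 \<le> (4 / N)\<^sup>2 / 2"
      using pi_less_4 by (intro divide_right_mono power_mono) auto
    ultimately show ?thesis by (simp add: e_def power_divide)
  qed
  moreover have "k t \<ge> 0" for t by (simp add: k_def)
  ultimately show ?thesis using that q_def by blast
qed

section \<open>Return times of linear flows on the torus\<close>

text \<open>Along the line s \<omega> + x, a product of periodic kernels becomes an almost periodic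
  function of s with frequencies 2 pi D . \<omega>, the form required by the averaging
  bound.\<close>

lemma trig_product_expansion:
  fixes c :: "'n::finite \<Rightarrow> int \<Rightarrow> complex" and x \<omega> :: "real^'n"
  shows "(\<Prod>j\<in>UNIV. \<Sum>d\<in>{- int N..int N}. c j d * cis (2 * pi * of_int d * (s * \<omega> $ j + x $ j)))
    = (\<Sum>D\<in>PiE UNIV (\<lambda>_. {- int N..int N}). (\<Prod>j\<in>UNIV. c j (D j)) *
        cis (2 * pi * (\<Sum>j\<in>UNIV. of_int (D j) * x $ j)) * cis (2 * pi * (\<Sum>j\<in>UNIV. of_int (D j) * \<omega> $ j) * s))"
proof -
  have "(\<Prod>j\<in>UNIV. c j (D j) * cis (2 * pi * of_int (D j) * (s * \<omega> $ j + x $ j))) =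
      (\<Prod>j\<in>UNIV. c j (D j)) * cis (2 * pi * (\<Sum>j\<in>UNIV. of_int (D j) * x $ j)) *
      cis (2 * pi * (\<Sum>j\<in>UNIV. of_int (D j) * \<omega> $ j) * s)" for D :: "'n \<Rightarrow> int"
    by (simp add: prod.distrib cis_sum[symmetric] cis_mult mult.assoc sum_distrib_left sum_distrib_right
      sum.distrib[symmetric] algebra_simps)
  thus ?thesis by (subst prod_sum_PiE) auto
qed

text \<open>A trigonometric polynomial on the torus is built that can be positive only near the
  integer lattice and whose mean is at least n/N^2. If the orbit avoided that neighbourhood, the
  polynomial would be nonpositive along it, and iterated averaging would make the mean smaller than
  this.\<close>

lemma diophantine_orbit_dense:
  fixes \<omega> :: "real^'n"
  assumes dio: "diophantine \<nu> \<eta> \<omega>"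
  obtains C where "C > 0"
    "\<And>(N::nat) x. N \<ge> 2 \<Longrightarrow> \<exists>s z. 0 \<le> s \<and> s \<le> C * real N powr (2 * \<eta>) \<and> int_vec z \<and>
       norm (s *\<^sub>R \<omega> + x - z) \<le> 2 * real CARD('n) ^ 2 / real N"
proof -
  define n where "n = CARD('n)"
  have n: "n \<ge> 1" by (simp add: n_def Suc_leI)
  have nu: "\<nu> > 0" and eta: "\<eta> > 0"
    and dioph: "\<And>z. int_vec z \<Longrightarrow> z \<noteq> 0 \<Longrightarrow> \<nu> * (\<Sum>i\<in>UNIV. \<bar>z $ i\<bar>) powr (- \<eta>) \<le> \<bar>\<omega> \<bullet> z\<bar>"
    using dio n unfolding diophantine_def n_def[symmetric] by auto
  \<comment> \<open>The requirement m \<eta> >= 3n + 2 collects the losses: N^n for the number of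
    frequencies, N^(2n) for the coefficients, and N^2 because the mean is only of order
    N^(-2).\<close>
  define m where "m = nat \<lceil>(3 * real n + 2) / \<eta>\<rceil> + 1"
  have m: "m \<ge> 1" "real m * \<eta> \<ge> 3 * real n + 2"
  proof -
    have "(3 * real n + 2) / \<eta> \<le> real m" unfolding m_def by linarith
    thus "real m * \<eta> \<ge> 3 * real n + 2" using eta by (simp add: field_simps)
  qed (simp add: m_def)
  \<comment> \<open>Chosen so that one average over the window \<open>T\<close> below gains exactly
    N^(-\<eta>) / 10^n. The 10^n beats the factor 9^n from counting frequencies (3^n) and bounding
    coefficients (3^n).\<close>
  define B where "B = 10 ^ n * real n powr \<eta> / (pi * \<nu>)"
  have B: "B > 0" using nu n by (simp add: B_def)
  show ?thesis
  proof
    show "real m * B > 0" using m B by simp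
    fix N :: nat and x :: "real^'n"
    assume N: "N \<ge> 2"
    define T where "T = B * real N powr (2 * \<eta>)"
    have T: "T > 0" using B N by (simp add: T_def)
    obtain k q q0 where k: "trig_poly N (3 * real N ^ 2) 1 k" and q: "trig_poly N (3 * real N ^ 2) (of_real q0) q"
      and q0: "q0 \<ge> 1 / real N ^ 2" and k0: "\<And>t. k t \<ge> 0"
      and qk: "\<And>t. q t = k t * (cos (2 * pi * t) - 1 + 9 / real N ^ 2)"
      using concentrated_kernel[OF N] by metis
    define M where "M = 3 * real N ^ 2"
    obtain ck where ck: "ck 0 = 1" "\<And>d. norm (ck d) \<le> M"
      "\<And>t. complex_of_real (k t) = (\<Sum>d\<in>{- int N..int N}. ck d * cis (2 * pi * of_int d * t))"
      using k unfolding trig_poly_def M_def by blast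
    obtain cq where cq: "cq 0 = of_real q0" "\<And>d. norm (cq d) \<le> M"
      "\<And>t. complex_of_real (q t) = (\<Sum>d\<in>{- int N..int N}. cq d * cis (2 * pi * of_int d * t))"
      using q unfolding trig_poly_def M_def by blast
    \<comment> \<open>The i-th summand of \<open>P\<close> carries \<open>q\<close> in coordinate i
      and the nonnegative kernel \<open>k\<close> in all others.\<close>
    define c where "c i j = (if j = i then cq else ck)" for i j :: 'n
    define f where "f i j = (if j = i then q else k)" for i j :: 'n
    define t where "t s j = s * \<omega> $ j + x $ j" for s j
    define P where "P s = (\<Sum>i\<in>UNIV. \<Prod>j\<in>UNIV. f i j (t s j))" for s
    define I where "I = PiE (UNIV :: 'n set) (\<lambda>_. {- int N..int N})"
    define \<alpha> where "\<alpha> D = 2 * pi * (\<Sum>j\<in>UNIV. of_int (D j) * \<omega> $ j)" for D :: "'n \<Rightarrow> int"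
    define A where "A D = (\<Sum>i\<in>UNIV. \<Prod>j\<in>UNIV. c i j (D j)) * cis (2 * pi * (\<Sum>j\<in>UNIV. of_int (D j) * x $ j))"
      for D :: "'n \<Rightarrow> int"
    have finI: "finite I" by (simp add: I_def finite_PiE)
    have fc: "complex_of_real (f i j r) = (\<Sum>d\<in>{- int N..int N}. c i j d * cis (2 * pi * of_int d * r))" for i j r
      by (simp add: f_def c_def ck cq)
    have Pexp: "complex_of_real (P s) = (\<Sum>D\<in>I. A D * cis (\<alpha> D * s))" for s
    proof -
      have "complex_of_real (P s) = (\<Sum>i\<in>UNIV. \<Prod>j\<in>UNIV. \<Sum>d\<in>{- int N..int N}.
          c i j d * cis (2 * pi * of_int d * (s * \<omega> $ j + x $ j)))"
        by (simp add: P_def fc t_def)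
      also have "\<dots> = (\<Sum>i\<in>UNIV. \<Sum>D\<in>I. (\<Prod>j\<in>UNIV. c i j (D j)) *
          cis (2 * pi * (\<Sum>j\<in>UNIV. of_int (D j) * x $ j)) * cis (\<alpha> D * s))"
        unfolding trig_product_expansion I_def \<alpha>_def ..
      also have "\<dots> = (\<Sum>D\<in>I. A D * cis (\<alpha> D * s))"
        by (subst sum.swap) (simp add: A_def sum_distrib_right)
      finally show ?thesis .
    qed
    \<comment> \<open>Every D in the box has l1 norm at most nN, so the Diophantine condition gives
      one small-divisor bound for all nonzero D.\<close>
    have alpha: "2 * pi * \<nu> * (real n * real N) powr (- \<eta>) \<le> \<bar>\<alpha> D\<bar>" if D: "D \<in> I" "D \<noteq> (\<lambda>_. 0)" for D
    proof -
      define z :: "real^'n" where "z = (\<chi> j. of_int (D j))"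
      have z: "int_vec z" "z \<noteq> 0" using D(2) by (auto simp: z_def int_vec_def vec_eq_iff fun_eq_iff)
      have "(\<Sum>i\<in>UNIV. \<bar>z $ i\<bar>) \<le> (\<Sum>i\<in>(UNIV::'n set). real N)"
      proof (rule sum_mono)
        fix i
        have "D i \<in> {- int N..int N}" using D(1) by (auto simp: I_def PiE_def)
        hence "\<bar>D i\<bar> \<le> int N" by auto
        thus "\<bar>z $ i\<bar> \<le> real N" by (simp add: z_def)
      qed
      hence le: "(\<Sum>i\<in>UNIV. \<bar>z $ i\<bar>) \<le> real n * real N" by (simp add: n_def)
      obtain i where "z $ i \<noteq> 0" using z(2) by (auto simp: vec_eq_iff)
      hence "0 < \<bar>z $ i\<bar>" by simp
      also have "\<dots> \<le> (\<Sum>i\<in>UNIV. \<bar>z $ i\<bar>)" by (rule member_le_sum) auto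
      finally have "(real n * real N) powr (- \<eta>) \<le> (\<Sum>i\<in>UNIV. \<bar>z $ i\<bar>) powr (- \<eta>)"
        using le eta by (intro powr_mono2') auto
      hence "\<nu> * (real n * real N) powr (- \<eta>) \<le> \<nu> * (\<Sum>i\<in>UNIV. \<bar>z $ i\<bar>) powr (- \<eta>)"
        using nu by (intro mult_left_mono) auto
      also have "\<dots> \<le> \<bar>\<omega> \<bullet> z\<bar>" by (rule dioph[OF z])
      finally have "2 * pi * (\<nu> * (real n * real N) powr (- \<eta>)) \<le> 2 * pi * \<bar>\<omega> \<bullet> z\<bar>"
        by (intro mult_left_mono) auto
      moreover have "\<omega> \<bullet> z = (\<Sum>j\<in>UNIV. of_int (D j) * \<omega> $ j)" by (simp add: inner_vec_def z_def mult.commute)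
      ultimately show ?thesis by (simp add: \<alpha>_def abs_mult mult.assoc)
    qed
    have low: "0 < 2 * pi * \<nu> * (real n * real N) powr (- \<eta>)" using nu n N by simp
    have I0: "(\<lambda>_. 0) \<in> I" by (auto simp: I_def PiE_def)
    \<comment> \<open>Nonresonance: only D = 0 contributes to the time mean, which is therefore n
      q0.\<close>
    have zero_set: "{D\<in>I. \<alpha> D = 0} = {\<lambda>_. 0}"
      using alpha low I0 by (force simp: \<alpha>_def)
    have "\<exists>s. 0 \<le> s \<and> s \<le> real m * T \<and> P s > 0"
    proof (rule ccontr)
      assume "\<not> ?thesis"
      hence neg: "\<And>s. 0 \<le> s \<Longrightarrow> s \<le> real m * T \<Longrightarrow> Re (\<Sum>D\<in>I. A D * cis (\<alpha> D * s)) \<le> 0"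
        unfolding Pexp[symmetric] by force
      have A0: "A (\<lambda>_. 0) = of_nat n * of_real q0"
      proof -
        have "(\<Prod>j\<in>UNIV. c i j 0) = of_real q0" for i
        proof -
          have "(\<Prod>j\<in>UNIV. c i j 0) = (\<Prod>j\<in>UNIV. if j = i then of_real q0 else 1)"
            by (intro prod.cong refl) (simp add: c_def ck cq)
          thus ?thesis by (simp add: prod.delta)
        qed
        thus ?thesis by (simp add: A_def n_def)
      qed
      have Anorm: "norm (A D) \<le> real n * M ^ n" for D
      proof -
        have "norm (A D) = norm (\<Sum>i\<in>UNIV. \<Prod>j\<in>UNIV. c i j (D j))" by (simp add: A_def norm_mult)
        also have "\<dots> \<le> (\<Sum>i\<in>UNIV. norm (\<Prod>j\<in>UNIV. c i j (D j)))" by (rule norm_sum)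
        also have "\<dots> \<le> (\<Sum>i\<in>(UNIV::'n set). \<Prod>j\<in>(UNIV::'n set). M)"
          unfolding prod_norm[symmetric]
          by (intro sum_mono prod_mono) (auto simp: c_def ck cq)
        finally show ?thesis by (simp add: n_def)
      qed
      define \<rho> where "\<rho> = real N powr (- \<eta>) / 10 ^ n"
      have \<rho>: "2 / (\<bar>\<alpha> D\<bar> * T) \<le> \<rho>" if D: "D \<in> I" "\<alpha> D \<noteq> 0" for D
      proof -
        have "D \<noteq> (\<lambda>_. 0)" using D(2) by (auto simp: \<alpha>_def)
        from alpha[OF D(1) this] have "2 / (\<bar>\<alpha> D\<bar> * T) \<le> 2 / (2 * pi * \<nu> * (real n * real N) powr (- \<eta>) * T)"
          using low T nu n N D(2) by (intro divide_left_mono mult_right_mono mult_pos_pos) auto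
        also have "\<dots> = \<rho>"
          using nu n N B by (simp add: \<rho>_def T_def B_def powr_mult powr_minus field_simps flip: powr_add)
        finally show ?thesis .
      qed
      \<comment> \<open>The lower bound for the mean is set against the remainder after
        \<open>m\<close> averages; the powers of N cancel and 1 <= (9/10)^n is left, a
        contradiction.\<close>
      have "real n * (1 / real N ^ 2) \<le> real n * q0" using q0 by (intro mult_left_mono) auto
      also have "\<dots> = Re (\<Sum>D\<in>{D\<in>I. \<alpha> D = 0}. A D)" by (simp add: zero_set A0)
      also have "\<dots> \<le> (\<Sum>D\<in>{D\<in>I. \<alpha> D \<noteq> 0}. norm (A D) * (2 / (\<bar>\<alpha> D\<bar> * T)) ^ m)"
        by (rule nonpos_almost_periodic_mean_bound[OF finI T neg])
      also have "\<dots> \<le> (\<Sum>D\<in>{D\<in>I. \<alpha> D \<noteq> 0}. (real n * M ^ n) * \<rho> ^ m)"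
        using \<rho> Anorm T by (intro sum_mono mult_mono power_mono) (auto simp: M_def)
      also have "\<dots> \<le> (\<Sum>D\<in>I. (real n * M ^ n) * \<rho> ^ m)"
        using finI by (intro sum_mono2) (auto simp: M_def \<rho>_def)
      also have "\<dots> = (2 * real N + 1) ^ n * ((real n * M ^ n) * \<rho> ^ m)"
        by (simp add: I_def card_PiE n_def)
      also have "\<dots> \<le> (3 * real N) ^ n * ((real n * M ^ n) * \<rho> ^ m)"
        using N by (intro mult_right_mono power_mono) (auto simp: M_def \<rho>_def)
      also have "\<dots> = real n * (9 ^ n * real N ^ (3 * n)) * \<rho> ^ m"
      proof -
        have "(3 * real N) ^ n * M ^ n = (3 * real N * M) ^ n" by (rule power_mult_distrib[symmetric])
        also have "3 * real N * M = 9 * real N ^ 3" by (simp add: M_def power3_eq_cube power2_eq_square)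
        also have "(9 * real N ^ 3) ^ n = 9 ^ n * real N ^ (3 * n)" by (simp add: power_mult_distrib power_mult)
        finally show ?thesis by (simp add: mult_ac)
      qed
      finally have "real n * (1 / real N ^ 2) \<le> real n * (9 ^ n * real N ^ (3 * n) * \<rho> ^ m)"
        by (simp only: mult.assoc)
      hence "1 / real N ^ 2 \<le> 9 ^ n * real N ^ (3 * n) * \<rho> ^ m"
        using n by (subst (asm) mult_le_cancel_left_pos) auto
      also have "\<dots> \<le> 9 ^ n * real N ^ (3 * n) * (1 / (real N ^ (3 * n) * real N ^ 2) / 10 ^ n)"
      proof (rule mult_left_mono)
        have "\<rho> ^ m = real N powr (- (real m * \<eta>)) / (10 ^ n) ^ m"
          using N by (simp add: \<rho>_def power_divide powr_power mult.commute)
        also have "\<dots> \<le> real N powr (- (real m * \<eta>)) / (10 ^ n) ^ 1"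
          using m by (intro divide_left_mono power_increasing) auto
        also have "\<dots> \<le> real N powr (- real (3 * n + 2)) / (10 ^ n) ^ 1"
          using m N by (intro divide_right_mono powr_mono) auto
        also have "real N powr (- real (3 * n + 2)) = 1 / real N ^ (3 * n + 2)"
          using N by (simp only: powr_minus powr_realpow) (simp add: inverse_eq_divide powr_realpow)
        finally show "\<rho> ^ m \<le> 1 / (real N ^ (3 * n) * real N ^ 2) / 10 ^ n"
          by (simp add: power_add power2_eq_square mult_ac)
      qed simp
      also have "\<dots> = (9 ^ n / 10 ^ n) * (1 / real N ^ 2)" using N by simp
      finally have "(1::real) \<le> 9 ^ n / 10 ^ n" using N by (simp add: field_simps)
      moreover have "(9::real) ^ n < 10 ^ n" using n by (intro power_strict_mono) auto
      ultimately show False by simp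
    qed
    then obtain s where s: "0 \<le> s" "s \<le> real m * T" "P s > 0" by blast
    define e where "e i = cos (2 * pi * t s i) - 1 + 9 / real N ^ 2" for i
    \<comment> \<open>As \<open>q\<close> is \<open>k\<close> times the multiplier, all summands
      share the weight given by the product of the \<open>k (t s j)\<close>. This weight is
      nonnegative, so positivity of \<open>P s\<close> passes to the sum of the \<open>e i\<close>,
      a bound on all cosine defects at once.\<close>
    have "P s = (\<Sum>i\<in>UNIV. e i * (\<Prod>j\<in>UNIV. k (t s j)))"
      unfolding P_def
    proof (intro sum.cong refl)
      fix i
      have "(\<Prod>j\<in>UNIV. f i j (t s j)) = (\<Prod>j\<in>UNIV. k (t s j) * (if j = i then e i else 1))"
        by (intro prod.cong refl) (auto simp: f_def qk e_def)
      thus "(\<Prod>j\<in>UNIV. f i j (t s j)) = e i * (\<Prod>j\<in>UNIV. k (t s j))"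
        by (simp add: prod.distrib prod.delta)
    qed
    hence "0 < (\<Sum>i\<in>UNIV. e i) * (\<Prod>j\<in>UNIV. k (t s j))" using s(3) by (simp add: sum_distrib_right)
    moreover have "0 \<le> (\<Prod>j\<in>UNIV. k (t s j))" by (intro prod_nonneg) (auto simp: k0)
    ultimately have "0 < (\<Sum>i\<in>UNIV. e i)" by (simp add: zero_less_mult_iff)
    hence sumlt: "(\<Sum>i\<in>UNIV. 1 - cos (2 * pi * t s i)) < 9 * real n / real N ^ 2"
      by (simp add: e_def sum.distrib sum_subtractf n_def mult.commute)
    define z :: "real^'n" where "z = (\<chi> i. of_int (round (t s i)))"
    have comp: "\<bar>t s i - z $ i\<bar> \<le> 2 * real n / real N" for i
    proof -
      define r where "r = t s i - z $ i"
      have "\<bar>r\<bar> \<le> 1/2" using of_int_round_abs_le[of "t s i"] by (simp add: r_def z_def abs_minus_commute)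
      hence "8 * r\<^sup>2 \<le> 1 - cos (2 * pi * r)" by (rule one_minus_cos_ge)
      also have "cos (2 * pi * r) = cos (2 * pi * t s i)"
      proof -
        have "cos (2 * pi * t s i - 2 * pi * of_int (round (t s i))) = cos (2 * pi * t s i)"
          using sin_int_2pin cos_int_2pin by (simp add: cos_diff)
        thus ?thesis by (simp add: r_def z_def right_diff_distrib)
      qed
      also have "1 - cos (2 * pi * t s i) \<le> (\<Sum>i\<in>UNIV. 1 - cos (2 * pi * t s i))"
        by (rule member_le_sum) auto
      also note sumlt
      also have "9 * real n / real N ^ 2 \<le> 32 * real n ^ 2 / real N ^ 2"
        using n by (intro divide_right_mono) (auto simp: power2_eq_square)
      finally have "r\<^sup>2 \<le> (2 * real n / real N)\<^sup>2" by (simp add: power_divide power_mult_distrib)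
      hence "\<bar>r\<bar> \<le> \<bar>2 * real n / real N\<bar>" by (simp only: abs_le_square_iff)
      thus ?thesis by (simp add: r_def)
    qed
    have "norm (s *\<^sub>R \<omega> + x - z) \<le> (\<Sum>i\<in>UNIV. \<bar>(s *\<^sub>R \<omega> + x - z) $ i\<bar>)" by (rule norm_le_l1_cart)
    also have "\<dots> \<le> (\<Sum>i\<in>(UNIV::'n set). 2 * real n / real N)"
      using comp by (intro sum_mono) (auto simp: t_def)
    also have "\<dots> = 2 * real CARD('n) ^ 2 / real N" by (simp add: n_def power2_eq_square)
    finally show "\<exists>s z. 0 \<le> s \<and> s \<le> real m * B * real N powr (2 * \<eta>) \<and> int_vec z \<and>
       norm (s *\<^sub>R \<omega> + x - z) \<le> 2 * real CARD('n) ^ 2 / real N"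
      using s by (intro exI[of _ s] exI[of _ z]) (auto simp: T_def int_vec_def z_def mult.assoc)
  qed
qed

section \<open>Viscosity subsolutions and characteristics\<close>

text \<open>The condition on \<zeta> says that f + \<zeta> is minimal at s, so -\<zeta> touches f
  from below there up to a constant and the left Dini derivative of f is at most -D. No
  differentiability of f enters, which suits a sup-convolution along an orbit.\<close>

lemma left_derivative_bound:
  fixes f :: "real \<Rightarrow> real"
  assumes T: "0 \<le> T" and cont: "continuous_on {0..T} f"
    and left: "\<And>s. 0 < s \<Longrightarrow> s \<le> T \<Longrightarrow> \<exists>\<zeta> D. (\<zeta> has_real_derivative D) (at s) \<and> - D \<le> B \<and>
      (\<forall>s'. f s - f s' \<le> \<zeta> s' - \<zeta> s)"
  shows "f T - f 0 \<le> B * T"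
proof -
  have "f T - f 0 \<le> (B + e) * T" if e: "e > 0" for e
  proof -
    \<comment> \<open>Continuation leftwards from \<open>T\<close>: \<open>S\<close> holds the times
      whose increment up to \<open>T\<close> respects the slope \<open>B + e\<close>. The margin
      \<open>e\<close> yields a strict inequality at \<open>Inf S\<close>, so \<open>S\<close> would
      extend further left unless the infimum is 0.\<close>
    define S where "S = {s\<in>{0..T}. f T - f s - (B + e) * (T - s) \<le> 0}"
    have "closed S" unfolding S_def
      using cont by (intro continuous_on_closed_Collect_le continuous_intros) auto
    moreover have TS: "T \<in> S" using T by (simp add: S_def)
    moreover have bdd: "bdd_below S" by (rule bdd_belowI[of _ 0]) (auto simp: S_def)
    ultimately have inf: "Inf S \<in> S" by (intro closed_contains_Inf) auto
    define s where "s = Inf S"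
    have s: "s \<in> S" "0 \<le> s" "s \<le> T" using inf by (auto simp: s_def S_def)
    have "s = 0"
    proof (rule ccontr)
      assume "s \<noteq> 0"
      with s have "0 < s" by simp
      then obtain \<zeta> D where z: "(\<zeta> has_real_derivative D) (at s)" "- D \<le> B" "\<And>s'. f s - f s' \<le> \<zeta> s' - \<zeta> s"
        using left[of s] s by blast
      have "((\<lambda>r. \<zeta> r + (B + e) * r) has_real_derivative D + (B + e)) (at s)"
        by (auto intro!: derivative_eq_intros z)
      moreover have "D + (B + e) > 0" using z e by simp
      ultimately obtain d where d: "d > 0" "\<And>h. 0 < h \<Longrightarrow> h < d \<Longrightarrow> \<zeta> (s - h) + (B + e) * (s - h) < \<zeta> s + (B + e) * s"
        using DERIV_pos_inc_left by blast
      define h where "h = min (d / 2) s"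
      have h: "0 < h" "h < d" "h \<le> s" using d \<open>0 < s\<close> by (auto simp: h_def)
      have "f s - f (s - h) \<le> (B + e) * h"
        using z(3)[of "s - h"] d(2)[OF h(1,2)] by (simp add: algebra_simps)
      hence "s - h \<in> S" using s h by (simp add: S_def algebra_simps)
      hence "s \<le> s - h" unfolding s_def using bdd by (intro cInf_lower)
      thus False using h by simp
    qed
    thus ?thesis using s(1) by (simp add: S_def)
  qed
  note main = this
  show ?thesis
  proof (cases "T = 0")
    case False
    show ?thesis
    proof (rule field_le_epsilon)
      fix e :: real assume "e > 0"
      hence "f T - f 0 \<le> (B + e / T) * T" using main[of "e / T"] T False by simp
      also have "\<dots> = B * T + e" using False by (simp add: distrib_right)
      finally show "f T - f 0 \<le> B * T + e" .
    qed
  qed simp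
qed

section \<open>Extrema of periodic functions and quadratic penalties\<close>

lemma periodic_shift_unit_cube:
  fixes x :: "real^'n"
  obtains z where "int_vec z" "x + z \<in> cbox 0 1"
proof
  show "int_vec (- (\<chi> i. of_int \<lfloor>x $ i\<rfloor>))" by (simp add: int_vec_def)
  show "x + - (\<chi> i. of_int \<lfloor>x $ i\<rfloor>) \<in> cbox 0 1"
    by (auto simp: mem_box_cart) linarith
qed

lemma periodic_continuous_bounded:
  fixes u :: "real^'n \<Rightarrow> 'b::real_normed_vector"
  assumes "continuous_on UNIV u" "periodic_fun u"
  obtains B where "B > 0" "\<And>x. norm (u x) \<le> B"
proof -
  have "compact (u ` cbox 0 1)"
    using assms(1) by (intro compact_continuous_image) (auto intro: continuous_on_subset)
  then obtain B where B: "B > 0" "\<And>y. y \<in> u ` cbox 0 1 \<Longrightarrow> norm y \<le> B"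
    by (meson bounded_pos compact_imp_bounded)
  show ?thesis
  proof
    show "B > 0" by fact
    fix x :: "real^'n"
    obtain z where z: "int_vec z" "x + z \<in> cbox 0 1" by (rule periodic_shift_unit_cube)
    have "u (x + z) = u x" using assms(2) z(1) by (simp add: periodic_fun_def)
    thus "norm (u x) \<le> B" using B(2)[OF imageI[OF z(2)]] by simp
  qed
qed

lemma periodic_attains_max:
  fixes u :: "real^'n \<Rightarrow> real"
  assumes "continuous_on UNIV u" "periodic_fun u"
  obtains x0 where "\<And>x. u x \<le> u x0"
proof -
  have "(0::real^'n) \<in> cbox 0 1" by (simp add: mem_box_cart)
  then obtain x0 where x0: "\<And>x. x \<in> cbox 0 1 \<Longrightarrow> u x \<le> u x0"
    using continuous_attains_sup[of "cbox 0 1" u] continuous_on_subset[OF assms(1), of "cbox 0 1"] by auto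
  show ?thesis
  proof
    fix x :: "real^'n"
    obtain z where z: "int_vec z" "x + z \<in> cbox 0 1" by (rule periodic_shift_unit_cube)
    have "u (x + z) = u x" using assms(2) z(1) by (simp add: periodic_fun_def)
    thus "u x \<le> u x0" using x0[OF z(2)] by simp
  qed
qed

lemma quadratic_penalty_max:
  fixes u :: "'a::euclidean_space \<Rightarrow> real"
  assumes cont: "continuous_on UNIV u" and bd: "\<And>y. \<bar>u y\<bar> \<le> B" and A: "A > 0"
  obtains y where "\<And>y'. u y' - A * (norm (y' - x))\<^sup>2 \<le> u y - A * (norm (y - x))\<^sup>2"
proof -
  \<comment> \<open>At distance \<open>r\<close> the penalty reaches 2B, the largest possible
    oscillation of u, so values outside the ball cannot exceed the value at x.\<close>
  define r where "r = sqrt (2 * B / A)"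
  have B: "B \<ge> 0" using bd[of 0] by simp
  have r: "r \<ge> 0" using A B by (simp add: r_def)
  have "compact (cball x r)" "cball x r \<noteq> {}" using r by auto
  moreover have "continuous_on (cball x r) (\<lambda>y. u y - A * (norm (y - x))\<^sup>2)"
    by (intro continuous_intros continuous_on_subset[OF cont]) auto
  ultimately obtain y where y: "\<And>y'. y' \<in> cball x r \<Longrightarrow> u y' - A * (norm (y' - x))\<^sup>2 \<le> u y - A * (norm (y - x))\<^sup>2"
    using continuous_attains_sup[of "cball x r" "\<lambda>y. u y - A * (norm (y - x))\<^sup>2"] by blast
  show ?thesis
  proof
    fix y'
    show "u y' - A * (norm (y' - x))\<^sup>2 \<le> u y - A * (norm (y - x))\<^sup>2"
    proof (cases "y' \<in> cball x r")
      case False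
      hence "r \<le> norm (y' - x)" by (simp add: dist_norm norm_minus_commute)
      hence "r\<^sup>2 \<le> (norm (y' - x))\<^sup>2" using r by (intro power_mono) auto
      hence "2 * B \<le> A * (norm (y' - x))\<^sup>2" using A B by (simp add: r_def field_simps)
      hence "u y' - A * (norm (y' - x))\<^sup>2 \<le> u x" using bd[of x] bd[of y'] by (auto simp: abs_le_iff)
      also have "u x \<le> u y - A * (norm (y - x))\<^sup>2" using y[of x] r by simp
      finally show ?thesis .
    qed (rule y)
  qed
qed

lemma C1_test_quadratic: "C1_test (\<lambda>y. A * (norm (y - x))\<^sup>2) (\<lambda>y. (2 * A) *\<^sub>R (y - x))"
  unfolding C1_test_def power2_norm_eq_inner
proof (intro conjI allI)
  show "continuous_on UNIV (\<lambda>y. (2 * A) *\<^sub>R (y - x))" by (intro continuous_intros)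
  fix y
  have 1: "((\<lambda>y. y - x) has_derivative (\<lambda>k. k)) (at y)" by (auto intro!: derivative_eq_intros)
  show "((\<lambda>y. A * ((y - x) \<bullet> (y - x))) has_derivative (\<lambda>k. ((2 * A) *\<^sub>R (y - x)) \<bullet> k)) (at y)"
    by (rule has_derivative_eq_rhs[OF has_derivative_mult_right[OF has_derivative_inner[OF 1 1]]])
       (simp add: fun_eq_iff inner_commute)
qed

text \<open>The sup-convolution of \<open>u\<close> with \<open>A \<bar>\<sqdot>\<bar>\<^sup>2\<close> has slopes bounded by the gradients of the
  quadratics touching \<open>u\<close> from above, uniformly in \<open>A\<close>.\<close>

lemma touching_gradient_bound_imp_lipschitz:
  fixes u :: "real^'n \<Rightarrow> real"
  assumes cont: "continuous_on UNIV u" and bd: "\<And>y. \<bar>u y\<bar> \<le> B"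
    and touch: "\<And>\<phi> D\<phi> x. C1_test \<phi> D\<phi> \<Longrightarrow> (\<And>y. u y - \<phi> y \<le> u x - \<phi> x) \<Longrightarrow> norm (D\<phi> x) \<le> R"
  shows "\<bar>u x - u y\<bar> \<le> R * norm (x - y)"
proof -
  have main: "u a - u b \<le> R * norm (a - b)" for a b
  proof (rule field_le_epsilon)
    fix e :: real assume e: "e > 0"
    have R: "R \<ge> 0"
    proof -
      obtain y where "\<And>y'. u y' - 1 * (norm (y' - 0))\<^sup>2 \<le> u y - 1 * (norm (y - 0))\<^sup>2"
        by (rule quadratic_penalty_max[OF cont bd, of 1 0]) auto
      thus ?thesis using touch[OF C1_test_quadratic[of 1 0]] norm_ge_zero order_trans by blast
    qed
    obtain d where d: "d > 0" "\<And>y. dist y b < d \<Longrightarrow> dist (u y) (u b) < e"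
      using cont e unfolding continuous_on_iff by (metis UNIV_I)
    \<comment> \<open>Large enough that the maximiser, which lies within R / (2A) of its centre,
      stays in the ball of radius \<open>d\<close> where u varies by less than
      \<open>e\<close>.\<close>
    define A where "A = R / d + 1"
    have A: "A > 0" using R d by (simp add: A_def add_nonneg_pos)
    have "\<exists>y. \<forall>y'. u y' - A * (norm (y' - x))\<^sup>2 \<le> u y - A * (norm (y - x))\<^sup>2" for x
      using quadratic_penalty_max[OF cont bd A, of x] by metis
    then obtain Y where Y: "\<And>x y'. u y' - A * (norm (y' - x))\<^sup>2 \<le> u (Y x) - A * (norm (Y x - x))\<^sup>2"
      by metis
    have YR: "2 * A * norm (Y x - x) \<le> R" for x
      using touch[OF C1_test_quadratic Y[of _ x]] A by simp
    define m where "m x = u (Y x) - A * (norm (Y x - x))\<^sup>2" for x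
    have step: "m x - m x' \<le> R * norm (x - x') + A * (norm (x - x'))\<^sup>2" for x x'
    proof -
      have "m x - m x' \<le> A * ((norm (Y x - x'))\<^sup>2 - (norm (Y x - x))\<^sup>2)"
        using Y[of "Y x" x'] by (simp add: m_def algebra_simps)
      also have "(norm (Y x - x'))\<^sup>2 \<le> (norm (Y x - x) + norm (x - x'))\<^sup>2"
        using norm_triangle_ineq[of "Y x - x" "x - x'"] by (intro power_mono) auto
      also have "\<dots> - (norm (Y x - x))\<^sup>2 = 2 * norm (Y x - x) * norm (x - x') + (norm (x - x'))\<^sup>2"
        by (simp add: power2_sum)
      finally have "m x - m x' \<le> (2 * A * norm (Y x - x)) * norm (x - x') + A * (norm (x - x'))\<^sup>2"
        using A by (simp add: algebra_simps)
      also have "\<dots> \<le> R * norm (x - x') + A * (norm (x - x'))\<^sup>2"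
        using YR by (intro add_right_mono mult_right_mono) auto
      finally show ?thesis .
    qed
    \<comment> \<open>Cutting the segment into \<open>Suc n\<close> equal pieces divides the
      quadratic error of \<open>step\<close> by \<open>Suc n\<close> while the linear term adds up
      unchanged; letting n grow removes the error.\<close>
    have sub: "m a - m b \<le> R * norm (a - b) + A * (norm (a - b))\<^sup>2 * (1 / real (Suc n))" for n
    proof -
      define p where "p i = b + (real i / real (Suc n)) *\<^sub>R (a - b)" for i
      have pd: "p (Suc i) - p i = (1 / real (Suc n)) *\<^sub>R (a - b)" for i
        by (simp add: p_def add_divide_distrib scaleR_left_distrib)
      have "m (p i) - m (p 0) \<le> real i * (R * norm (a - b) / real (Suc n) + A * (norm (a - b))\<^sup>2 / (real (Suc n))\<^sup>2)" for i
      proof (induction i)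
        case (Suc i)
        have "m (p (Suc i)) - m (p i) \<le> R * norm (a - b) / real (Suc n) + A * (norm (a - b))\<^sup>2 / (real (Suc n))\<^sup>2"
          using step[of "p (Suc i)" "p i"] unfolding pd by (simp add: power_divide power_mult_distrib)
        thus ?case using Suc unfolding of_nat_Suc[of i] distrib_right mult_1_left by linarith
      qed simp
      moreover have "real (Suc n) * (X / real (Suc n) + Y / (real (Suc n))\<^sup>2) = X + Y * (1 / real (Suc n))" for X Y
        by (simp add: distrib_left power2_eq_square del: of_nat_Suc)
      moreover have "p (Suc n) = a" "p 0 = b" by (simp_all add: p_def del: of_nat_Suc)
      ultimately show ?thesis by metis
    qed
    have "(\<lambda>n. R * norm (a - b) + A * (norm (a - b))\<^sup>2 * (1 / real (Suc n)))
        \<longlonglongrightarrow> R * norm (a - b) + A * (norm (a - b))\<^sup>2 * 0"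
      by (intro tendsto_intros lim_1_over_n[THEN LIMSEQ_Suc])
    hence "m a - m b \<le> R * norm (a - b)"
      using sub by (intro LIMSEQ_le_const[of "\<lambda>n. R * norm (a - b) + A * (norm (a - b))\<^sup>2 * (1 / real (Suc n))"]) auto
    moreover have "u a \<le> m a" using Y[of a a] by (simp add: m_def)
    moreover have "m b \<le> u b + e"
    proof -
      have "norm (Y b - b) < d"
      proof (rule ccontr)
        assume "\<not> ?thesis"
        hence "2 * A * d \<le> 2 * A * norm (Y b - b)" using A by simp
        with YR[of b] have "2 * A * d \<le> R" by linarith
        moreover have "A * d = R + d" using d by (simp add: A_def distrib_right)
        ultimately show False using d R by simp
      qed
      hence "u (Y b) \<le> u b + e" using d(2)[of "Y b"] by (simp add: dist_norm)
      moreover have "m b \<le> u (Y b)" using A by (simp add: m_def)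
      ultimately show ?thesis by simp
    qed
    ultimately show "u a - u b \<le> R * norm (a - b) + e" by linarith
  qed
  show ?thesis using main[of x y] main[of y x] by (simp add: abs_le_iff norm_minus_commute)
qed

text \<open>Along a characteristic of the classical solution \<open>v\<close>, the sup-convolution of \<open>u\<close> has left Dini
  derivative at most \<open>H\<^sub>p \<sqdot> p\<close> for a supergradient \<open>p\<close> of \<open>u\<close> at a nearby point; convexity bounds
  this by the derivative of \<open>v\<close> plus \<open>k - hc\<close>.\<close>

lemma subsolution_along_characteristic:
  fixes u v :: "real^'n \<Rightarrow> real" and X :: "real \<Rightarrow> real^'n" and H :: "real^'n \<Rightarrow> real^'n \<Rightarrow> real"
  assumes contH: "continuous_on UNIV (\<lambda>z. H (fst z) (snd z))"
    and conv: "\<And>x p q. H x p + b x p \<bullet> (q - p) \<le> H x q"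
    and cont: "continuous_on UNIV u" and bd: "\<And>y. \<bar>u y\<bar> \<le> B"
    and lip: "\<And>x y. \<bar>u x - u y\<bar> \<le> R * norm (x - y)" and R: "R > 0"
    and sub: "\<And>\<phi> D\<phi> y. C1_test \<phi> D\<phi> \<Longrightarrow> (\<And>y'. u y' - \<phi> y' \<le> u y - \<phi> y) \<Longrightarrow> H y (c + D\<phi> y) \<le> k"
    and v: "\<And>x. (v has_derivative (\<lambda>h. g x \<bullet> h)) (at x)"
    and eq: "\<And>x. H x (c + g x) = hc"
    and traj: "\<And>s. (X has_vector_derivative b (X s) (c + g (X s))) (at s)"
    and T: "T \<ge> 0"
  shows "u (X T) - v (X T) \<le> u (X 0) - v (X 0) + (k - hc) * T"
proof (rule field_le_epsilon)
  fix e0 :: real assume "e0 > 0"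
  define e where "e = e0 / (1 + T)"
  have e: "e > 0" "e * (1 + T) = e0" using \<open>e0 > 0\<close> T by (auto simp: e_def)
  have Xcont: "continuous_on S X" for S
    using traj by (intro continuous_at_imp_continuous_on) (auto intro: has_vector_derivative_continuous)
  have "compact (X ` {0..T})" by (intro compact_continuous_image Xcont) auto
  hence "bounded (X ` {0..T})" by (rule compact_imp_bounded)
  then obtain \<rho> where \<rho>: "\<And>s. s \<in> {0..T} \<Longrightarrow> norm (X s) \<le> \<rho>"
    unfolding bounded_iff by blast
  \<comment> \<open>Compact set containing all pairs (X s, c + p) and (y, c + p) that occur below: y
    is within 1 of the orbit, and the quadratic's gradient p has norm at most 2R.\<close>
  define Z where "Z = cball (0::real^'n) (\<rho> + 1) \<times> cball (0::real^'n) (norm c + 2 * R)"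
  have "uniformly_continuous_on Z (\<lambda>z. H (fst z) (snd z))"
    unfolding Z_def by (intro compact_uniformly_continuous continuous_on_subset[OF contH] compact_Times) auto
  then obtain d where d: "d > 0" "\<And>z z'. z \<in> Z \<Longrightarrow> z' \<in> Z \<Longrightarrow> dist z' z < d \<Longrightarrow>
      dist (H (fst z') (snd z')) (H (fst z) (snd z)) < e"
    using e(1) by (rule uniformly_continuous_onE) blast
  define d1 where "d1 = min d 1"
  have d1: "d1 > 0" "d1 \<le> 1" "d1 \<le> d" using d by (auto simp: d1_def)
  \<comment> \<open>The first term keeps the maximiser within \<open>d1\<close> of its centre, the
    second makes the sup-convolution exceed u by at most \<open>e\<close>.\<close>
  define A where "A = 2 * R / d1 + R\<^sup>2 / e"
  have A: "A > 0" using R d1 e by (simp add: A_def add_pos_pos)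
  have RA: "R / A < d1"
  proof -
    have "R < 2 * R / d1 * d1" using R d1 by simp
    also have "\<dots> \<le> A * d1" using d1 e by (intro mult_right_mono) (auto simp: A_def)
    finally show ?thesis using A by (simp add: field_simps)
  qed
  have R2A: "R * (R / A) \<le> e"
  proof -
    have "R\<^sup>2 / e * e \<le> A * e" using R d1 e by (intro mult_right_mono) (auto simp: A_def)
    hence "R\<^sup>2 \<le> A * e" using e by simp
    thus ?thesis using A by (simp add: field_simps power2_eq_square)
  qed
  have "\<exists>y. \<forall>y'. u y' - A * (norm (y' - x))\<^sup>2 \<le> u y - A * (norm (y - x))\<^sup>2" for x
    using quadratic_penalty_max[OF cont bd A, of x] by metis
  then obtain Y where Y: "\<And>x y'. u y' - A * (norm (y' - x))\<^sup>2 \<le> u (Y x) - A * (norm (Y x - x))\<^sup>2"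
    by metis
  define m where "m x = u (Y x) - A * (norm (Y x - x))\<^sup>2" for x
  have YR: "A * norm (Y x - x) \<le> R" for x
  proof -
    have "A * (norm (Y x - x))\<^sup>2 \<le> R * norm (Y x - x)"
      using Y[of x x] lip[of "Y x" x] by (simp add: abs_le_iff)
    hence "(A * norm (Y x - x)) * norm (Y x - x) \<le> R * norm (Y x - x)"
      by (simp add: power2_eq_square)
    thus ?thesis using R by (cases "norm (Y x - x) = 0") (auto simp: mult_le_cancel_right)
  qed
  hence YRA: "norm (Y x - x) \<le> R / A" for x using A by (simp add: field_simps)
  have m_ge: "u x \<le> m x" for x using Y[of x x] by (simp add: m_def)
  have m_le: "m x \<le> u x + e" for x
  proof -
    have "m x \<le> u (Y x)" using A by (simp add: m_def)
    also have "\<dots> \<le> u x + R * norm (Y x - x)" using lip[of "Y x" x] by (simp add: abs_le_iff)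
    also have "\<dots> \<le> u x + R * (R / A)" using YRA[of x] R by (intro add_left_mono mult_left_mono) auto
    finally show ?thesis using R2A by simp
  qed
  have "m x - m x' \<le> R * norm (x - x')" for x x'
  proof -
    have "u (Y x + (x' - x)) - A * (norm (Y x - x))\<^sup>2 \<le> m x'"
      using Y[of "Y x + (x' - x)" x'] by (simp add: m_def)
    moreover have "u (Y x) - u (Y x + (x' - x)) \<le> R * norm (x - x')"
      using lip[of "Y x" "Y x + (x' - x)"] by (simp add: abs_le_iff norm_minus_commute)
    ultimately show ?thesis by (simp add: m_def)
  qed
  hence "dist (m x) (m x') \<le> R * dist x x'" for x x'
    by (smt (verit) dist_norm norm_minus_commute real_norm_def)
  hence "R-lipschitz_on UNIV m" using R by (intro lipschitz_onI) auto
  hence mcont: "continuous_on UNIV m" by (rule lipschitz_on_continuous_on)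
  have vcont: "continuous_on UNIV v" using v by (meson has_derivative_continuous_on has_derivative_at_withinI)
  have "m (X T) - v (X T) - (m (X 0) - v (X 0)) \<le> (k - hc + e) * T"
  proof (rule left_derivative_bound[OF T])
    show "continuous_on {0..T} (\<lambda>s. m (X s) - v (X s))"
      by (intro continuous_intros continuous_on_compose2[OF mcont Xcont] continuous_on_compose2[OF vcont Xcont]) auto
    fix s assume s: "0 < s" "s \<le> T"
    define y where "y = Y (X s)"
    define p where "p = (2 * A) *\<^sub>R (y - X s)"
    define bs where "bs = b (X s) (c + g (X s))"
    \<comment> \<open>Holding the maximiser y for time s fixed, u(y) minus the penalty bounds m(X
      s') from below with equality at s' = s. Hence u(y) - \<zeta> is a smooth lower barrier for m -
      v along the orbit.\<close>
    define \<zeta> where "\<zeta> s' = A * ((X s' - y) \<bullet> (X s' - y)) + v (X s')" for s'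
    have X': "(X has_derivative (\<lambda>h. h *\<^sub>R bs)) (at s)"
      using traj[of s] by (simp add: has_vector_derivative_def bs_def)
    have 1: "((\<lambda>s'. X s' - y) has_derivative (\<lambda>h. h *\<^sub>R bs)) (at s)"
      using X' by (auto intro!: derivative_eq_intros)
    have "(\<zeta> has_derivative (\<lambda>h. h * ((g (X s) - p) \<bullet> bs))) (at s)"
      unfolding \<zeta>_def[abs_def]
      by (rule has_derivative_eq_rhs[OF has_derivative_add[OF
            has_derivative_mult_right[OF has_derivative_inner[OF 1 1]] has_derivative_compose[OF X' v]]])
         (auto simp: fun_eq_iff p_def inner_commute algebra_simps inner_diff_left inner_diff_right)
    hence "(\<zeta> has_real_derivative (g (X s) - p) \<bullet> bs) (at s)"
      by (simp add: has_field_derivative_def mult_commute_abs)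
    moreover have "- ((g (X s) - p) \<bullet> bs) \<le> k - hc + e"
    proof -
      have "- ((g (X s) - p) \<bullet> bs) = bs \<bullet> ((c + p) - (c + g (X s)))"
        by (simp add: inner_diff_left inner_diff_right inner_commute)
      also have "\<dots> \<le> H (X s) (c + p) - hc"
        using conv[of "X s" "c + g (X s)" "c + p"] by (simp add: bs_def eq)
      finally have 2: "- ((g (X s) - p) \<bullet> bs) \<le> H (X s) (c + p) - hc" .
      have "norm p \<le> 2 * R" using YR[of "X s"] A by (simp add: p_def y_def)
      hence cp: "norm (c + p) \<le> norm c + 2 * R" using norm_triangle_ineq[of c p] by simp
      have yX: "norm (y - X s) < d1" using YRA[of "X s"] RA by (simp add: y_def)
      hence "norm y \<le> \<rho> + 1"
        using d1 \<rho>[of s] s norm_triangle_ineq[of "y - X s" "X s"] by simp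
      moreover have "dist (X s, c + p) (y, c + p) < d"
        using yX d1 by (simp add: dist_Pair_Pair dist_norm norm_minus_commute)
      moreover have "norm (X s) \<le> \<rho> + 1" using \<rho>[of s] s by simp
      \<comment> \<open>The subsolution inequality is available at y, whereas convexity is applied
        at X s; uniform continuity of H moves between them at cost \<open>e\<close>.\<close>
      ultimately have "dist (H (X s) (c + p)) (H y (c + p)) < e"
        using d(2)[of "(y, c + p)" "(X s, c + p)"] cp by (simp add: Z_def)
      moreover have "H y (c + p) \<le> k"
        using sub[OF C1_test_quadratic[of A "X s"], of y] Y[of _ "X s"] by (simp add: p_def y_def)
      ultimately have "H (X s) (c + p) \<le> k + e" by (simp add: dist_norm abs_less_iff)
      thus ?thesis using 2 by simp
    qed
    moreover have "m (X s) - v (X s) - (m (X s') - v (X s')) \<le> \<zeta> s' - \<zeta> s" for s'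
      using Y[of y "X s'"]
      by (simp add: m_def y_def \<zeta>_def power2_norm_eq_inner inner_diff_left inner_diff_right inner_commute algebra_simps)
    ultimately show "\<exists>\<zeta> D. (\<zeta> has_real_derivative D) (at s) \<and> - D \<le> k - hc + e \<and>
      (\<forall>s'. m (X s) - v (X s) - (m (X s') - v (X s')) \<le> \<zeta> s' - \<zeta> s)" by blast
  qed
  moreover have "(k - hc + e) * T = (k - hc) * T + e * T" by (simp add: algebra_simps)
  moreover have "e * (1 + T) = e + e * T" by (simp add: algebra_simps)
  ultimately show "u (X T) - v (X T) \<le> u (X 0) - v (X 0) + (k - hc) * T + e0"
    using m_ge[of "X T"] m_le[of "X 0"] e(2) by linarith
qed

section \<open>Hamiltonian flow\<close>

lemma gradient_unique:
  fixes g g' :: "'a::real_inner"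
  assumes "(f has_derivative (\<lambda>k. g \<bullet> k)) (at x)" "(f has_derivative (\<lambda>k. g' \<bullet> k)) (at x)"
  shows "g = g'"
  using has_derivative_unique[OF assms] by (metis vector_eq_rdot)

lemma bounded_periodic_strip:
  fixes F :: "(real^'n) \<times> (real^'n) \<Rightarrow> 'b::real_normed_vector"
  assumes "continuous_on UNIV F" "\<And>x p z. int_vec z \<Longrightarrow> F (x + z, p) = F (x, p)"
  obtains B where "B > 0" "\<And>w. norm (snd w) \<le> r \<Longrightarrow> norm (F w) \<le> B"
proof -
  have "compact (F ` (cbox 0 1 \<times> cball 0 r))"
    by (intro compact_continuous_image continuous_on_subset[OF assms(1)] compact_Times) auto
  hence "bounded (F ` (cbox 0 1 \<times> cball 0 r))" by (rule compact_imp_bounded)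
  then obtain B where B: "B > 0" "\<forall>y \<in> F ` (cbox 0 1 \<times> cball 0 r). norm y \<le> B"
    unfolding bounded_pos by blast
  show ?thesis
  proof
    show "B > 0" by fact
    fix w :: "(real^'n) \<times> (real^'n)" assume w: "norm (snd w) \<le> r"
    obtain z where z: "int_vec z" "fst w + z \<in> cbox 0 1" by (rule periodic_shift_unit_cube)
    have "F w = F (fst w + z, snd w)" using assms(2)[OF z(1), of "fst w" "snd w"] by simp
    moreover have "F (fst w + z, snd w) \<in> F ` (cbox 0 1 \<times> cball 0 r)" using z(2) w by (intro imageI) auto
    ultimately show "norm (F w) \<le> B" using B(2) by auto
  qed
qed

text \<open>Fixes the joint gradient \<open>G\<close> and its derivative \<open>G'\<close>, so that
  the definite descriptions \<open>Hp\<close>, \<open>Hx\<close> and \<open>Hpp\<close> can be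
  replaced by components of these.\<close>

locale C2_hamiltonian =
  fixes H :: "real^'n \<Rightarrow> real^'n \<Rightarrow> real" and G G'
  assumes ton: "tonelli H"
    and G: "\<And>z. ((\<lambda>z. H (fst z) (snd z)) has_derivative (\<lambda>k. G z \<bullet> k)) (at z)"
    and G': "\<And>z. (G has_derivative blinfun_apply (G' z)) (at z)"
    and G'cont: "continuous_on UNIV G'"
begin

lemma gradient_snd: "((\<lambda>q. H x q) has_derivative (\<lambda>k. snd (G (x, p)) \<bullet> k)) (at p)"
proof -
  have "((\<lambda>q. (x, q)) has_derivative (\<lambda>k. (0, k))) (at p)" by (auto intro!: derivative_eq_intros)
  from has_derivative_compose[OF this G] show ?thesis by (simp add: inner_prod_def)
qed

lemma gradient_fst: "((\<lambda>y. H y p) has_derivative (\<lambda>k. fst (G (x, p)) \<bullet> k)) (at x)"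
proof -
  have "((\<lambda>y. (y, p)) has_derivative (\<lambda>k. (k, 0))) (at x)" by (auto intro!: derivative_eq_intros)
  from has_derivative_compose[OF this G] show ?thesis by (simp add: inner_prod_def)
qed

lemma Hp_eq: "Hp H x p = snd (G (x, p))"
  unfolding Hp_def using gradient_snd gradient_unique by (intro the_equality) blast+

lemma Hx_eq: "Hx H x p = fst (G (x, p))"
  unfolding Hx_def using gradient_fst gradient_unique by (intro the_equality) blast+

lemma Hp_derivative: "((\<lambda>q. Hp H x q) has_derivative (\<lambda>k. snd (blinfun_apply (G' (x, p)) (0, k)))) (at p)"
proof -
  have "((\<lambda>q. (x, q)) has_derivative (\<lambda>k. (0, k))) (at p)" by (auto intro!: derivative_eq_intros)
  from has_derivative_snd[OF has_derivative_compose[OF this G']] show ?thesis by (simp add: Hp_eq)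
qed

lemma Hpp_derivative: "((\<lambda>q. Hp H x q) has_derivative Hpp H x p) (at p)"
proof -
  have "Hpp H x p = (\<lambda>k. snd (blinfun_apply (G' (x, p)) (0, k)))"
    unfolding Hpp_def using Hp_derivative has_derivative_unique by (intro the_equality) blast+
  thus ?thesis using Hp_derivative by simp
qed

text \<open>Along the segment from p to q the second derivative of H is the \<open>Hpp\<close> form,
  which is nonnegative; so the slope at an intermediate mean-value point is at least the initial
  slope.\<close>

lemma convex_in_momentum: "H x p + Hp H x p \<bullet> (q - p) \<le> H x q"
proof -
  define l where "l t = p + t *\<^sub>R (q - p)" for t :: real
  have l: "(l has_derivative (\<lambda>h. h *\<^sub>R (q - p))) (at t)" for t
    unfolding l_def[abs_def] by (auto intro!: derivative_eq_intros)
  define h' where "h' t = Hp H x (l t) \<bullet> (q - p)" for t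
  have h: "((\<lambda>t. H x (l t)) has_real_derivative h' t) (at t)" for t
    using has_derivative_compose[OF l gradient_snd[unfolded Hp_eq[symmetric]]]
    by (simp add: has_field_derivative_def h'_def mult_commute_abs)
  have hh: "(h' has_real_derivative Hpp H x (l t) (q - p) \<bullet> (q - p)) (at t)" for t
  proof -
    have lin: "linear (Hpp H x (l t))" using Hpp_derivative has_derivative_linear by blast
    have d: "((\<lambda>t. Hp H x (l t)) has_derivative (\<lambda>h. h *\<^sub>R Hpp H x (l t) (q - p))) (at t)"
      using has_derivative_compose[OF l[of t] Hpp_derivative[of x "l t"]] by (simp add: linear_scale[OF lin])
    show ?thesis
      using has_derivative_inner_left[OF d, of "q - p"]
      by (simp add: has_field_derivative_def h'_def[abs_def] mult_commute_abs)
  qed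
  have pos: "Hpp H x (l t) (q - p) \<bullet> (q - p) \<ge> 0" for t
    using ton unfolding tonelli_def
    by (cases "q - p = 0") (auto intro: less_imp_le)
  obtain \<xi> where \<xi>: "0 < \<xi>" "\<xi> < 1" "H x (l 1) - H x (l 0) = (1 - 0) * h' \<xi>"
    using MVT2[of 0 1 "\<lambda>t. H x (l t)" h'] h by auto
  have "h' 0 \<le> h' \<xi>"
    by (rule DERIV_nonneg_imp_nondecreasing) (use hh pos \<xi> in auto)
  thus ?thesis using \<xi>(3) by (simp add: h'_def l_def)
qed

lemma periodic_H: "int_vec z \<Longrightarrow> H (x + z) p = H x p"
  using ton by (auto simp: tonelli_def periodic_fun_def)

lemma periodic_G:
  assumes z: "int_vec z"
  shows "G (x + z, p) = G (x, p)"
proof -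
  have "((\<lambda>w. w + (z, 0)) has_derivative (\<lambda>k. k)) (at (x, p))" by (auto intro!: derivative_eq_intros)
  from has_derivative_compose[OF this G]
  have "((\<lambda>w. H (fst w) (snd w)) has_derivative (\<lambda>k. G (x + z, p) \<bullet> k)) (at (x, p))"
    using periodic_H[OF z] by simp
  thus ?thesis using G gradient_unique by blast
qed

lemma periodic_G':
  assumes z: "int_vec z"
  shows "G' (x + z, p) = G' (x, p)"
proof -
  have 1: "((\<lambda>w. w + (z, 0)) has_derivative (\<lambda>k. k)) (at (x, p))" by (auto intro!: derivative_eq_intros)
  have "(\<lambda>w. G (w + (z, 0))) = G" using periodic_G[OF z] by (auto simp: fun_eq_iff)
  hence "(G has_derivative blinfun_apply (G' (x + z, p))) (at (x, p))"
    using has_derivative_compose[OF 1 G'] by simp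
  hence "blinfun_apply (G' (x + z, p)) = blinfun_apply (G' (x, p))" using G' has_derivative_unique by blast
  thus ?thesis by (simp add: blinfun_apply_inject)
qed

section \<open>Energy conservation and completeness of the flow\<close>

definition ham_field :: "(real^'n) \<times> (real^'n) \<Rightarrow> (real^'n) \<times> (real^'n)" where
  "ham_field w = (snd (G w), - fst (G w))"

lemma ham_traj_iff: "ham_traj H \<gamma> \<longleftrightarrow> (\<forall>s. (\<gamma> has_vector_derivative ham_field (\<gamma> s)) (at s))"
  by (simp add: ham_traj_def Hp_eq Hx_eq ham_field_def)

text \<open>The field is orthogonal to the gradient of H, so any scalar multiple of it preserves H.
  The factor \<open>a s\<close> covers both the cut-off field and, with value 1, the original
  one.\<close>

lemma energy_conserved:
  assumes "\<And>s. (\<gamma> has_vector_derivative a s *\<^sub>R ham_field (\<gamma> s)) (at s)"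
  shows "H (fst (\<gamma> s)) (snd (\<gamma> s)) = H (fst (\<gamma> 0)) (snd (\<gamma> 0))"
proof -
  have "((\<lambda>s. H (fst (\<gamma> s)) (snd (\<gamma> s))) has_real_derivative 0) (at s)" for s
  proof -
    have "(\<gamma> has_derivative (\<lambda>h. h *\<^sub>R a s *\<^sub>R ham_field (\<gamma> s))) (at s)"
      using assms[of s] by (simp add: has_vector_derivative_def)
    from has_derivative_compose[OF this G]
    show ?thesis
      by (simp add: has_field_derivative_def ham_field_def inner_prod_def inner_commute flip: lambda_zero)
  qed
  thus ?thesis using DERIV_isconst_all by blast
qed

text \<open>Multiplying the Hamiltonian field by a cutoff in \<open>p\<close> makes it globally Lipschitz without
  spoiling conservation of \<open>H\<close>, so by coercivity orbits never see the cutoff.\<close>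

lemma ham_traj_exists_unique:
  "\<exists>!\<gamma>. ham_traj H \<gamma> \<and> \<gamma> 0 = z"
proof -
  define E where "E = H (fst z) (snd z)"
  obtain R0 where R0: "\<And>x p. norm p \<ge> R0 \<Longrightarrow> H x p \<ge> 1 * norm p"
    using ton unfolding tonelli_def by metis
  \<comment> \<open>If |p| >= r, coercivity gives H >= |p| >= E + 1, so the energy level E lies
    inside |p| < r, where the cutoff equals 1.\<close>
  define r where "r = max R0 (E + 1)"
  have level: "norm p < r" if "H x p = E" for x p
    using R0[of p x] that by (force simp: r_def)
  define cut where "cut w = max 0 (min 1 (r + 1 - norm (snd w)))" for w :: "(real^'n) \<times> (real^'n)"
  define F where "F w = cut w *\<^sub>R ham_field w" for w
  have contG: "continuous_on UNIV G" using G' by (meson has_derivative_continuous_on has_derivative_at_withinI)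
  obtain B1 where B1: "B1 > 0" "\<And>w. norm (snd w) \<le> r + 1 \<Longrightarrow> norm (G w) \<le> B1"
    using bounded_periodic_strip[OF contG periodic_G] by metis
  obtain B2 where B2: "B2 > 0" "\<And>w. norm (snd w) \<le> r + 1 \<Longrightarrow> norm (G' w) \<le> B2"
    using bounded_periodic_strip[OF G'cont periodic_G'] by metis
  have strip: "UNIV \<times> cball 0 (r + 1) = {w::(real^'n) \<times> (real^'n). norm (snd w) \<le> r + 1}" by auto
  have norm_field: "norm (ham_field w) = norm (G w)" for w
    by (simp add: ham_field_def norm_prod_def add.commute)
  have field_lip: "norm (ham_field w - ham_field w') \<le> B2 * norm (w - w')"
    if "norm (snd w) \<le> r + 1" "norm (snd w') \<le> r + 1" for w w'
  proof -
    have "norm (G w - G w') \<le> B2 * norm (w - w')"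
    proof (rule differentiable_bound)
      show "convex (UNIV \<times> cball (0::real^'n) (r + 1) :: ((real^'n) \<times> (real^'n)) set)" by (intro convex_Times) auto
      show "(G has_derivative blinfun_apply (G' y)) (at y within UNIV \<times> cball 0 (r + 1))" for y
        using G' by (rule has_derivative_at_withinI)
      show "onorm (blinfun_apply (G' y)) \<le> B2" if "y \<in> UNIV \<times> cball 0 (r + 1)" for y
        using B2(2)[of y] that by (auto simp: norm_blinfun.rep_eq)
    qed (use that in \<open>auto simp: strip\<close>)
    moreover have "norm (ham_field w - ham_field w') = norm (G w - G w')"
      by (simp add: ham_field_def norm_prod_def add.commute norm_minus_commute)
    ultimately show ?thesis by simp
  qed
  have cut01: "0 \<le> cut w" "cut w \<le> 1" for w by (auto simp: cut_def)
  have cut_lip: "\<bar>cut w - cut w'\<bar> \<le> norm (w - w')" for w w'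
  proof -
    have "\<bar>cut w - cut w'\<bar> \<le> \<bar>norm (snd w) - norm (snd w')\<bar>" unfolding cut_def by linarith
    also have "\<dots> \<le> norm (snd w - snd w')" by (rule norm_triangle_ineq3)
    also have "\<dots> \<le> norm (w - w')" using norm_snd_le[of "snd (w - w')" "fst (w - w')"]
      by (metis prod.collapse snd_diff)
    finally show ?thesis .
  qed
  define L where "L = B1 + B2"
  have L: "L > 0" using B1 B2 by (simp add: L_def)
  \<comment> \<open>Only \<open>w\<close> has to lie in the strip: the field is bounded at
    \<open>w\<close>, and if \<open>w'\<close> lies outside then \<open>cut w'\<close> is 0 and
    kills the second term.\<close>
  have half: "norm (F w - F w') \<le> L * norm (w - w')" if w: "norm (snd w) \<le> r + 1" for w w'
  proof -
    have dec: "F w - F w' = (cut w - cut w') *\<^sub>R ham_field w + cut w' *\<^sub>R (ham_field w - ham_field w')"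
      by (simp add: F_def algebra_simps)
    have 1: "norm ((cut w - cut w') *\<^sub>R ham_field w) \<le> norm (w - w') * B1"
      using cut_lip[of w w'] B1(2)[OF w] by (simp add: norm_field mult_mono)
    have 2: "norm (cut w' *\<^sub>R (ham_field w - ham_field w')) \<le> B2 * norm (w - w')"
    proof (cases "norm (snd w') \<le> r + 1")
      case True
      thus ?thesis using field_lip[OF w True] cut01[of w'] mult_mono[of "cut w'" 1 "norm (ham_field w - ham_field w')"] by simp
    next
      case False
      hence "cut w' = 0" by (simp add: cut_def)
      thus ?thesis using B2 by simp
    qed
    show ?thesis using 1 2 norm_triangle_ineq[of "(cut w - cut w') *\<^sub>R ham_field w"]
      unfolding dec L_def by (smt (verit) distrib_right mult.commute)
  qed
  have lip: "norm (F w - F w') \<le> L * norm (w - w')" for w w'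
  proof (cases "norm (snd w) \<le> r + 1")
    case False
    show ?thesis
    proof (cases "norm (snd w') \<le> r + 1")
      case True
      thus ?thesis using half[of w' w] by (simp add: norm_minus_commute)
    next
      case f: False
      have "F w = 0" "F w' = 0" using False f by (auto simp: F_def cut_def)
      thus ?thesis using L by simp
    qed
  qed (rule half)
  have cut1: "cut (\<gamma> s) = 1" if "H (fst (\<gamma> s)) (snd (\<gamma> s)) = E" for \<gamma> and s :: real
    using level[OF that] by (simp add: cut_def)
  obtain \<gamma> where \<gamma>: "\<gamma> 0 = z" "\<And>s. (\<gamma> has_vector_derivative F (\<gamma> s)) (at s)"
    using lipschitz_ode_exists[OF lip L] by blast
  have "H (fst (\<gamma> s)) (snd (\<gamma> s)) = E" for s
    using energy_conserved[of \<gamma> "\<lambda>s. cut (\<gamma> s)" s] \<gamma> by (simp add: F_def E_def)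
  hence "F (\<gamma> s) = ham_field (\<gamma> s)" for s using cut1[of \<gamma> s] by (simp add: F_def)
  hence ex: "ham_traj H \<gamma> \<and> \<gamma> 0 = z" using \<gamma> by (simp add: ham_traj_iff)
  \<comment> \<open>Any competing trajectory also stays on the energy level E, hence solves the
    cut-off equation, whose solutions are unique.\<close>
  moreover have "\<delta> = \<gamma>" if \<delta>: "ham_traj H \<delta> \<and> \<delta> 0 = z" for \<delta>
  proof
    fix s
    have d: "\<And>s. (\<delta> has_vector_derivative ham_field (\<delta> s)) (at s)" using \<delta> by (simp add: ham_traj_iff)
    hence "H (fst (\<delta> s)) (snd (\<delta> s)) = E" for s
      using energy_conserved[of \<delta> "\<lambda>_. 1" s] \<delta> by (simp add: E_def)
    hence "F (\<delta> s) = ham_field (\<delta> s)" for s using cut1[of \<delta> s] by (simp add: F_def)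
    hence "\<And>s. (\<delta> has_vector_derivative F (\<delta> s)) (at s)" using d by simp
    thus "\<delta> s = \<gamma> s" using lipschitz_ode_unique[OF lip _ \<gamma>(2)] \<gamma>(1) \<delta> by metis
  qed
  ultimately show ?thesis by blast
qed

lemma ham_flow_traj: "ham_traj H (\<lambda>s. ham_flow H s z)" "ham_flow H 0 z = z"
  using theI'[OF ham_traj_exists_unique[of z]] by (simp_all add: ham_flow_def)

end

lemma tonelli_C2_hamiltonian:
  assumes "tonelli H"
  obtains G G' where "C2_hamiltonian H G G'"
proof -
  have "C2_fun (\<lambda>z. H (fst z) (snd z))" using assms by (simp add: tonelli_def)
  then obtain G G' where "C2_hamiltonian H G G'"
    using assms unfolding C2_hamiltonian_def C2_fun_def by blast
  thus ?thesis by (rule that)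
qed

section \<open>Regularity of invariant graphs\<close>

lemma int_vec_add: "int_vec x \<Longrightarrow> int_vec y \<Longrightarrow> int_vec (x + y)"
  by (simp add: int_vec_def)

lemma int_vec_minus: "int_vec x \<Longrightarrow> int_vec (- x)"
  by (simp add: int_vec_def)

lemma int_vec_diff: "int_vec x \<Longrightarrow> int_vec y \<Longrightarrow> int_vec (x - y)"
  by (simp add: int_vec_def)

lemma closed_int_vec: "closed {z::real^'n. int_vec z}"
proof -
  have "{z::real^'n. int_vec z} = (\<Inter>i. (\<lambda>z. z $ i) -` \<int>)" by (auto simp: int_vec_def)
  moreover have "closed ((\<lambda>z::real^'n. z $ i) -` \<int>)" for i
    by (intro closed_vimage closed_Ints continuous_intros)
  ultimately show ?thesis by auto
qed

lemma int_vec_small: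
  fixes z :: "real^'n"
  assumes "int_vec z" "norm z < 1"
  shows "z = 0"
proof (rule ccontr)
  assume "z \<noteq> 0"
  then obtain i where i: "z $ i \<noteq> 0" by (auto simp: vec_eq_iff)
  have "1 \<le> \<bar>z $ i\<bar>" using assms(1) i by (intro Ints_nonzero_abs_ge1) (auto simp: int_vec_def)
  thus False using component_le_norm_cart[of z i] assms(2) by simp
qed

lemma has_derivative_periodic_translate:
  fixes v :: "real^'n \<Rightarrow> 'b::real_normed_vector"
  assumes "(v has_derivative L) (at x)" "periodic_fun v" "int_vec z"
  shows "(v has_derivative L) (at (x + z))"
proof -
  have "((\<lambda>y. y - z) has_derivative (\<lambda>k. k)) (at (x + z))" by (auto intro!: derivative_eq_intros)
  moreover have "(v has_derivative L) (at (x + z - z))" using assms(1) by simp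
  ultimately have "((\<lambda>y. v (y - z)) has_derivative L) (at (x + z))"
    by (rule has_derivative_compose)
  moreover have "v (y - z) = v y" for y
    using assms(2,3) int_vec_minus[OF assms(3)] unfolding periodic_fun_def
    by (metis diff_conv_add_uminus)
  ultimately show ?thesis by simp
qed

text \<open>To be instantiated with the C^1 parametrisation that conjugates the flow to rotation, so
  that regularity of v and closeness of orbits come from the same \<phi>.\<close>

locale torus_graph =
  fixes c :: "real^'n" and v :: "real^'n \<Rightarrow> real" and \<phi> \<psi> :: "real^'n \<Rightarrow> real^'n"
  assumes emb: "torus_embedding \<phi> \<psi> (graph_c c v)" and C1\<phi>: "C1_map \<phi>" and C1\<psi>: "C1_map \<psi>"
begin

lemma cont: "continuous_on UNIV \<phi>" "continuous_on UNIV \<psi>"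
  using C1\<phi> C1\<psi> unfolding C1_map_def
  by (meson has_derivative_continuous_on has_derivative_at_withinI)+

lemma \<phi>_shift: "int_vec k \<Longrightarrow> int_vec (\<phi> (\<theta> + k) - \<phi> \<theta>)"
  using emb by (simp add: torus_embedding_def)

lemma in_graph: "(v has_derivative (\<lambda>k. (\<psi> \<theta> - c) \<bullet> k)) (at (\<phi> \<theta>))"
proof -
  have "(\<phi> \<theta>, \<psi> \<theta>) \<in> graph_c c v" using emb by (simp add: torus_embedding_def)
  then obtain g where "\<psi> \<theta> = c + g" "(v has_derivative (\<lambda>k. g \<bullet> k)) (at (\<phi> \<theta>))"
    by (auto simp: graph_c_def)
  thus ?thesis by simp
qed

text \<open>The graph property makes \<open>\<phi>\<close> injective on small balls, so invariance of domain applies.\<close>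

lemma open_image_mod:
  assumes "open S"
  shows "open {x. \<exists>\<theta>\<in>S. tor_eq x (\<phi> \<theta>)}"
proof -
  have inj: "inj_on \<phi> (ball a (1/2))" for a
  proof (rule inj_onI)
    fix x y assume xy: "x \<in> ball a (1/2)" "y \<in> ball a (1/2)" "\<phi> x = \<phi> y"
    \<comment> \<open>Two parameters over the same base point both give c plus the unique gradient
      of v there; the embedding then identifies them modulo integers, and the ball is too small for
      a nonzero integer shift.\<close>
    have "(v has_derivative (\<lambda>k. (\<psi> y - c) \<bullet> k)) (at (\<phi> x))" using in_graph[of y] xy by simp
    hence "(\<lambda>k. (\<psi> x - c) \<bullet> k) = (\<lambda>k. (\<psi> y - c) \<bullet> k)" by (rule has_derivative_unique[OF in_graph])
    hence "\<psi> x - c = \<psi> y - c" by (metis vector_eq_rdot)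
    hence "\<psi> x = \<psi> y" by simp
    hence "tor_eq x y" using emb xy(3) by (simp add: torus_embedding_def tor_eq_def int_vec_def)
    moreover have "norm (x - y) < 1"
      using xy(1,2) dist_triangle_half_r[of a x 1 y] by (simp add: dist_norm)
    ultimately have "x - y = 0" unfolding tor_eq_def by (intro int_vec_small)
    thus "x = y" by simp
  qed
  have op: "open (\<phi> ` S')" if "open S'" for S'
  proof -
    have "\<phi> ` S' = (\<Union>a\<in>S'. \<phi> ` (ball a (1/2) \<inter> S'))" by (auto intro!: imageI)
    moreover have "open (\<phi> ` (ball a (1/2) \<inter> S'))" for a
      using that inj cont(1)
      by (intro invariance_of_domain) (auto intro: continuous_on_subset inj_on_subset)
    ultimately show ?thesis by auto
  qed
  have "{x. \<exists>\<theta>\<in>S. tor_eq x (\<phi> \<theta>)} = (\<Union>z\<in>{z. int_vec z}. (+) z ` (\<phi> ` S))" (is "?L = ?R")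
  proof (intro set_eqI iffI)
    fix x assume "x \<in> ?L"
    then obtain \<theta> where "\<theta> \<in> S" "int_vec (x - \<phi> \<theta>)" by (auto simp: tor_eq_def)
    moreover have "x = (x - \<phi> \<theta>) + \<phi> \<theta>" by simp
    ultimately show "x \<in> ?R" by blast
  next
    fix x assume "x \<in> ?R"
    then obtain z \<theta> where "int_vec z" "\<theta> \<in> S" "x = z + \<phi> \<theta>" by blast
    thus "x \<in> ?L" by (auto simp: tor_eq_def intro!: bexI[of _ \<theta>])
  qed
  thus ?thesis using op[OF assms] by (auto intro!: open_translation)
qed

text \<open>Modulo integers the image of \<phi> is open by \<open>open_image_mod\<close>, and closed
  as the sum of a compact set and the integer lattice; connectedness makes it everything. Thus v is
  differentiable over every point, although the definition of the graph does not say so.\<close>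

lemma \<phi>_surj_mod:
  obtains \<theta> where "\<theta> \<in> cbox 0 1" "tor_eq x (\<phi> \<theta>)"
proof -
  define U where "U = {x. \<exists>\<theta>\<in>UNIV. tor_eq x (\<phi> \<theta>)}"
  define C where "C = cbox (0::real^'n) 1"
  have inC: "\<exists>\<theta>\<in>C. tor_eq x (\<phi> \<theta>)" if x: "x \<in> U" for x
  proof -
    obtain \<theta> where \<theta>: "tor_eq x (\<phi> \<theta>)" using x by (auto simp: U_def)
    obtain z where z: "int_vec z" "\<theta> + z \<in> cbox 0 1" by (rule periodic_shift_unit_cube)
    have "int_vec ((x - \<phi> \<theta>) - (\<phi> (\<theta> + z) - \<phi> \<theta>))"
      using \<theta> \<phi>_shift[OF z(1)] by (intro int_vec_diff[of "x - \<phi> \<theta>"]) (auto simp: tor_eq_def)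
    hence "tor_eq x (\<phi> (\<theta> + z))" by (simp add: tor_eq_def)
    thus ?thesis using z(2) by (auto simp: C_def)
  qed
  have U: "U = (\<Union>y\<in>\<phi> ` C. \<Union>z\<in>{z. int_vec z}. {y + z})" (is "_ = ?R")
  proof (intro set_eqI iffI)
    fix x assume "x \<in> U"
    then obtain \<theta> where "\<theta> \<in> C" "int_vec (x - \<phi> \<theta>)" using inC unfolding tor_eq_def by blast
    moreover have "x = \<phi> \<theta> + (x - \<phi> \<theta>)" by simp
    ultimately show "x \<in> ?R" by blast
  next
    fix x assume "x \<in> ?R"
    then obtain z \<theta> where "int_vec z" "x = \<phi> \<theta> + z" by blast
    thus "x \<in> U" by (auto simp: U_def tor_eq_def intro!: exI[of _ \<theta>])
  qed
  have "closed U" unfolding U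
    by (intro compact_closed_sums compact_continuous_image closed_int_vec continuous_on_subset[OF cont(1)])
       (auto simp: C_def)
  moreover have "open U" unfolding U_def by (rule open_image_mod) auto
  moreover have "\<phi> 0 \<in> U" by (auto simp: U_def tor_eq_def int_vec_def intro!: exI[of _ 0])
  ultimately have "U = UNIV" using clopen[of U] by auto
  thus ?thesis using that inC[of x] by (auto simp: C_def)
qed

text \<open>The gradient at x is \<psi>(\<theta>) - c for every \<theta> lying over x. Its
  continuity is inherited from \<psi>: preimages of open sets are images modulo integers of open
  parameter sets, which are open.\<close>

lemma graph_function_C1:
  assumes per: "periodic_fun v"
  obtains g where "C1_test v g"
proof -
  have ex: "\<exists>\<theta>. tor_eq x (\<phi> \<theta>) \<and> (v has_derivative (\<lambda>k. (\<psi> \<theta> - c) \<bullet> k)) (at x)" for x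
  proof -
    obtain \<theta> where \<theta>: "tor_eq x (\<phi> \<theta>)" by (rule \<phi>_surj_mod)
    thus ?thesis using has_derivative_periodic_translate[OF in_graph[of \<theta>] per, of "x - \<phi> \<theta>"]
      by (auto simp: tor_eq_def)
  qed
  then obtain \<Theta> where \<Theta>: "\<And>x. tor_eq x (\<phi> (\<Theta> x))" "\<And>x. (v has_derivative (\<lambda>k. (\<psi> (\<Theta> x) - c) \<bullet> k)) (at x)"
    by metis
  define g where "g x = \<psi> (\<Theta> x) - c" for x
  have g: "(v has_derivative (\<lambda>k. g x \<bullet> k)) (at x)" for x using \<Theta>(2) by (simp add: g_def)
  have g_eq: "g x = \<psi> \<theta> - c" if "tor_eq x (\<phi> \<theta>)" for x \<theta>
  proof -
    have "(v has_derivative (\<lambda>k. (\<psi> \<theta> - c) \<bullet> k)) (at x)"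
      using has_derivative_periodic_translate[OF in_graph[of \<theta>] per, of "x - \<phi> \<theta>"] that by (auto simp: tor_eq_def)
    hence "(\<lambda>k. g x \<bullet> k) = (\<lambda>k. (\<psi> \<theta> - c) \<bullet> k)" by (rule has_derivative_unique[OF g])
    thus ?thesis by (metis vector_eq_rdot)
  qed
  have "continuous_on UNIV g"
  proof (subst continuous_on_open_vimage, simp, intro allI impI)
    fix O' :: "(real^'n) set" assume O: "open O'"
    have "open ((\<lambda>\<theta>. \<psi> \<theta> - c) -` O')" by (intro open_vimage O continuous_intros cont)
    hence "open {x. \<exists>\<theta>\<in>(\<lambda>\<theta>. \<psi> \<theta> - c) -` O'. tor_eq x (\<phi> \<theta>)}" by (rule open_image_mod)
    moreover have "{x. \<exists>\<theta>\<in>(\<lambda>\<theta>. \<psi> \<theta> - c) -` O'. tor_eq x (\<phi> \<theta>)} = g -` O'"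
      using g_eq \<Theta>(1) by force
    ultimately show "open (g -` O' \<inter> UNIV)" by simp
  qed
  hence "C1_test v g" using g by (simp add: C1_test_def)
  thus ?thesis by (rule that)
qed

text \<open>C^1 gives Lipschitz bounds only on compact sets. This suffices, because a target
  parameter can be taken in the unit cube and the orbit misses it by a bounded vector.\<close>

lemma \<phi>_lipschitz_near_cube:
  obtains L where "L > 0" "\<And>\<theta> e. \<theta> \<in> cbox 0 1 \<Longrightarrow> norm e \<le> r \<Longrightarrow> norm (\<phi> (\<theta> + e) - \<phi> \<theta>) \<le> L * norm e"
proof -
  obtain f' where f': "\<And>y. (\<phi> has_derivative blinfun_apply (f' y)) (at y)" "continuous_on UNIV f'"
    using C1\<phi> unfolding C1_map_def by blast
  have "bounded (cbox (0::real^'n) 1)" by simp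
  then obtain \<rho> where \<rho>: "\<forall>x\<in>cbox (0::real^'n) 1. norm x \<le> \<rho>" unfolding bounded_iff by blast
  have "compact (f' ` cball 0 (\<rho> + r))"
    by (intro compact_continuous_image continuous_on_subset[OF f'(2)]) auto
  hence "bounded (f' ` cball 0 (\<rho> + r))" by (rule compact_imp_bounded)
  then obtain L where L: "L > 0" "\<forall>y\<in>f' ` cball 0 (\<rho> + r). norm y \<le> L" unfolding bounded_pos by blast
  show ?thesis
  proof
    show "L > 0" by fact
    fix \<theta> e :: "real^'n" assume \<theta>: "\<theta> \<in> cbox 0 1" and e: "norm e \<le> r"
    have "norm (\<phi> (\<theta> + e) - \<phi> \<theta>) \<le> L * norm ((\<theta> + e) - \<theta>)"
    proof (rule differentiable_bound)
      show "convex (cball (0::real^'n) (\<rho> + r))" by simp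
      show "(\<phi> has_derivative blinfun_apply (f' y)) (at y within cball 0 (\<rho> + r))" for y
        using f'(1) by (rule has_derivative_at_withinI)
      show "onorm (blinfun_apply (f' y)) \<le> L" if "y \<in> cball 0 (\<rho> + r)" for y
        using L(2) that by (auto simp: norm_blinfun.rep_eq)
      have "norm \<theta> \<le> \<rho>" using \<rho> \<theta> by blast
      moreover have "0 \<le> r" using e norm_ge_zero order_trans by blast
      ultimately show "\<theta> + e \<in> cball 0 (\<rho> + r)" "\<theta> \<in> cball 0 (\<rho> + r)"
        using e norm_triangle_ineq[of \<theta> e] by auto
    qed
    thus "norm (\<phi> (\<theta> + e) - \<phi> \<theta>) \<le> L * norm e" by simp
  qed
qed

end

section \<open>Rate of convergence\<close>

lemma viscosity_solutionD:
  fixes u :: "real^'n \<Rightarrow> real"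
  assumes "viscosity_solution F u"
  shows "continuous_on UNIV u" "periodic_fun u"
    "\<And>\<phi> D\<phi> x. C1_test \<phi> D\<phi> \<Longrightarrow> (\<And>y. u y - \<phi> y \<le> u x - \<phi> x) \<Longrightarrow> F x (u x) (D\<phi> x) \<le> 0"
    "\<And>\<phi> D\<phi> x. C1_test \<phi> D\<phi> \<Longrightarrow> (\<And>y. u y - \<phi> y \<ge> u x - \<phi> x) \<Longrightarrow> F x (u x) (D\<phi> x) \<ge> 0"
proof -
  show "continuous_on UNIV u" "periodic_fun u" using assms by (simp_all add: viscosity_solution_def)
  fix \<phi> :: "real^'n \<Rightarrow> real" and D\<phi> x
  assume t: "C1_test \<phi> D\<phi>"
  show "F x (u x) (D\<phi> x) \<le> 0" if "\<And>y. u y - \<phi> y \<le> u x - \<phi> x"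
  proof -
    have "\<exists>r>0. \<forall>y\<in>ball x r. u y - \<phi> y \<le> u x - \<phi> x" using that by (intro exI[of _ 1]) auto
    thus ?thesis using assms t unfolding viscosity_solution_def by blast
  qed
  show "F x (u x) (D\<phi> x) \<ge> 0" if "\<And>y. u y - \<phi> y \<ge> u x - \<phi> x"
  proof -
    have "\<exists>r>0. \<forall>y\<in>ball x r. u y - \<phi> y \<ge> u x - \<phi> x" using that by (intro exI[of _ 1]) auto
    thus ?thesis using assms t unfolding viscosity_solution_def by blast
  qed
qed

text \<open>At an extremum of u - v the test function v makes H(x, c + v_x) - h(c) cancel. Only the
  sign of \<epsilon> u is left there, which gives a bound independent of \<epsilon>.\<close>

lemma discounted_solution_bound:
  fixes H :: "real^'n \<Rightarrow> real^'n \<Rightarrow> real"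
  assumes test: "C1_test v g" and eq: "\<And>x. H x (c + g x) = hc" and per: "periodic_fun v"
    and bd: "\<And>x. \<bar>v x\<bar> \<le> B" and \<epsilon>: "\<epsilon> > 0"
    and sol: "viscosity_solution (\<lambda>x r p. \<epsilon> * r + H x (c + p) - hc) u"
  shows "\<bar>u x\<bar> \<le> 2 * B"
proof -
  note vs = viscosity_solutionD[OF sol]
  have contv: "continuous_on UNIV v"
    using test unfolding C1_test_def by (meson has_derivative_continuous_on has_derivative_at_withinI)
  obtain x0 where x0: "\<And>x. u x - v x \<le> u x0 - v x0"
  proof (rule periodic_attains_max[of "\<lambda>x. u x - v x"])
    show "continuous_on UNIV (\<lambda>x. u x - v x)" by (intro continuous_intros vs(1) contv)
    show "periodic_fun (\<lambda>x. u x - v x)" using vs(2) per by (simp add: periodic_fun_def)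
  qed blast
  have "\<epsilon> * u x0 \<le> 0" using vs(3)[OF test x0] eq by simp
  hence "u x0 \<le> 0" using \<epsilon> by (simp add: mult_le_0_iff)
  hence "u x \<le> 2 * B" using x0[of x] bd[of x] bd[of x0] by (simp add: abs_le_iff)
  moreover obtain x1 where x1: "\<And>x. v x - u x \<le> v x1 - u x1"
  proof (rule periodic_attains_max[of "\<lambda>x. v x - u x"])
    show "continuous_on UNIV (\<lambda>x. v x - u x)" by (intro continuous_intros vs(1) contv)
    show "periodic_fun (\<lambda>x. v x - u x)" using vs(2) per by (simp add: periodic_fun_def)
  qed blast
  have "u x1 - v x1 \<le> u y - v y" for y using x1[of y] by simp
  hence "\<epsilon> * u x1 \<ge> 0" using vs(4)[OF test, of x1] eq by simp
  hence "u x1 \<ge> 0" using \<epsilon> by (simp add: zero_le_mult_iff)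
  hence "- u x \<le> 2 * B" using x1[of x] bd[of x] bd[of x1] by (simp add: abs_le_iff)
  ultimately show ?thesis by (simp add: abs_le_iff)
qed

text \<open>The orbit from x is followed until it is within order 1/N of y: growth along the orbit
  costs the first term, and the Lipschitz bound for the remaining gap costs the second.\<close>

lemma KAM_oscillation_bound:
  fixes H :: "real^'n \<Rightarrow> real^'n \<Rightarrow> real" and v :: "real^'n \<Rightarrow> real"
  assumes ton: "tonelli H"
    and vis: "viscosity_solution (\<lambda>x r p. H x (c + p) - hc) v"
    and KAM: "KAM_torus H c v \<nu> \<eta> \<omega>"
    and ve: "\<And>\<epsilon>. \<epsilon> > 0 \<Longrightarrow> viscosity_solution (\<lambda>x r p. \<epsilon> * r + H x (c + p) - hc) (ve \<epsilon>)"
  obtains K1 K2 where "K1 > 0" "K2 > 0"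
    "\<And>\<epsilon> (N::nat) x y. 0 < \<epsilon> \<Longrightarrow> \<epsilon> \<le> 1 \<Longrightarrow> 2 \<le> N \<Longrightarrow>
      (ve \<epsilon> y - v y) - (ve \<epsilon> x - v x) \<le> K1 * (\<epsilon> * real N powr (2 * \<eta>)) + K2 / real N"
proof -
  obtain \<phi> \<psi> where emb: "C1_map \<phi>" "C1_map \<psi>" "torus_embedding \<phi> \<psi> (graph_c c v)"
    and conj: "\<And>z. z \<in> graph_c c v \<Longrightarrow> \<exists>\<theta>0. \<forall>s. tor_eq (fst (ham_flow H s z)) (\<phi> (s *\<^sub>R \<omega> + \<theta>0)) \<and>
            snd (ham_flow H s z) = \<psi> (s *\<^sub>R \<omega> + \<theta>0)"
    using KAM unfolding KAM_torus_def by blast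
  have inv: "\<And>z s. z \<in> graph_c c v \<Longrightarrow> ham_flow H s z \<in> graph_c c v" and dio: "diophantine \<nu> \<eta> \<omega>"
    using KAM by (auto simp: KAM_torus_def)
  interpret torus_graph c v \<phi> \<psi> using emb by unfold_locales
  obtain G G' where "C2_hamiltonian H G G'" using tonelli_C2_hamiltonian[OF ton] by blast
  then interpret C2_hamiltonian H G G' .
  note vD = viscosity_solutionD[OF vis]
  obtain g where test: "C1_test v g" using graph_function_C1[OF vD(2)] by blast
  have g: "\<And>x. (v has_derivative (\<lambda>k. g x \<bullet> k)) (at x)" using test by (simp add: C1_test_def)
  \<comment> \<open>Being C^1, v is an admissible test function for itself from both sides, so it
    solves the equation classically.\<close>
  have eq: "H x (c + g x) = hc" for x
    using vD(3)[OF test, of x] vD(4)[OF test, of x] by simp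
  obtain B where B: "B > 0" "\<And>x. \<bar>v x\<bar> \<le> B"
    using periodic_continuous_bounded[OF vD(1,2)] by (metis real_norm_def)
  define K where "K = 2 * B"
  have K: "K > 0" using B by (simp add: K_def)
  obtain R0 where R0: "\<And>x p. norm p \<ge> R0 \<Longrightarrow> H x p \<ge> 1 * norm p"
    using ton unfolding tonelli_def by metis
  \<comment> \<open>One gradient bound for the sublevel hc + K, which serves v and, since \<epsilon>
    <= 1, also every discounted solution.\<close>
  define R where "R = norm c + \<bar>R0\<bar> + \<bar>hc + K\<bar> + 1"
  have R: "R > 0" by (simp add: R_def add_nonneg_pos)
  have coercive: "norm p \<le> R" if "H x (c + p) \<le> hc + K" for x p
  proof -
    have "norm (c + p) \<le> \<bar>R0\<bar> + \<bar>hc + K\<bar>"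
      using R0[of "c + p" x] that by (cases "norm (c + p) \<ge> R0") auto
    moreover have "norm p \<le> norm (c + p) + norm c" using norm_triangle_ineq4[of "c + p" c] by simp
    ultimately show ?thesis by (simp add: R_def)
  qed
  have lipv: "\<bar>v x - v y\<bar> \<le> R * norm (x - y)" for x y
  proof (rule touching_gradient_bound_imp_lipschitz[OF vD(1) B(2)])
    fix \<phi> D\<phi> x assume "C1_test \<phi> D\<phi>" "\<And>y. v y - \<phi> y \<le> v x - \<phi> x"
    from vD(3)[OF this] show "norm (D\<phi> x) \<le> R" using K by (intro coercive[of x]) auto
  qed
  obtain L where L: "L > 0" "\<And>\<theta> e. \<theta> \<in> cbox 0 1 \<Longrightarrow> norm e \<le> 2 * real CARD('n) ^ 2 \<Longrightarrow>
      norm (\<phi> (\<theta> + e) - \<phi> \<theta>) \<le> L * norm e"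
    using \<phi>_lipschitz_near_cube[of "2 * real CARD('n) ^ 2"] by blast
  obtain C where C: "C > 0" "\<And>(N::nat) x. N \<ge> 2 \<Longrightarrow> \<exists>s z. 0 \<le> s \<and> s \<le> C * real N powr (2 * \<eta>) \<and>
      int_vec z \<and> norm (s *\<^sub>R \<omega> + x - z) \<le> 2 * real CARD('n) ^ 2 / real N"
    using diophantine_orbit_dense[OF dio] by blast
  show ?thesis
  proof
    show "K * C > 0" using K C by simp
    show "2 * R * L * (2 * real CARD('n) ^ 2) > 0" using R L by simp
    fix \<epsilon> :: real and N :: nat and x y
    assume \<epsilon>: "0 < \<epsilon>" "\<epsilon> \<le> 1" and N: "2 \<le> N"
    define u where "u = ve \<epsilon>"
    define w where "w x = u x - v x" for x
    note uD = viscosity_solutionD[OF ve[OF \<epsilon>(1)], folded u_def]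
    have ub: "\<bar>u x\<bar> \<le> K" for x
      unfolding K_def u_def by (rule discounted_solution_bound[OF test eq vD(2) B(2) \<epsilon>(1) ve[OF \<epsilon>(1)]])
    have sub: "H x (c + D\<phi> x) \<le> hc + \<epsilon> * K" if "C1_test \<phi> D\<phi>" "\<And>y. u y - \<phi> y \<le> u x - \<phi> x" for \<phi> D\<phi> x
    proof -
      have "\<epsilon> * u x + H x (c + D\<phi> x) - hc \<le> 0" by (rule uD(3)[OF that])
      moreover have "\<epsilon> * (- u x) \<le> \<epsilon> * K" using ub[of x] \<epsilon> by (intro mult_left_mono) (auto simp: abs_le_iff)
      ultimately show ?thesis by simp
    qed
    have lipu: "\<bar>u x - u y\<bar> \<le> R * norm (x - y)" for x y
    proof (rule touching_gradient_bound_imp_lipschitz[OF uD(1) ub])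
      fix \<phi> D\<phi> x assume "C1_test \<phi> D\<phi>" "\<And>y. u y - \<phi> y \<le> u x - \<phi> x"
      hence "H x (c + D\<phi> x) \<le> hc + \<epsilon> * K" by (rule sub)
      moreover have "\<epsilon> * K \<le> 1 * K" using \<epsilon> K by (intro mult_right_mono) auto
      ultimately show "norm (D\<phi> x) \<le> R" by (intro coercive[of x]) auto
    qed
    have lipw: "w a - w b \<le> 2 * R * norm (a - b)" for a b
      using lipu[of a b] lipv[of a b] by (simp add: w_def abs_le_iff)
    have perw: "w a = w b" if "tor_eq a b" for a b
    proof -
      have "int_vec (a - b)" using that by (simp add: tor_eq_def)
      hence "u (b + (a - b)) = u b" "v (b + (a - b)) = v b"
        using uD(2) vD(2) by (auto simp only: periodic_fun_def)
      thus ?thesis by (simp add: w_def)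
    qed
    define z0 where "z0 = (x, c + g x)"
    have z0: "z0 \<in> graph_c c v" using g by (auto simp: z0_def graph_c_def)
    obtain \<theta>0 where \<theta>0: "\<And>s. tor_eq (fst (ham_flow H s z0)) (\<phi> (s *\<^sub>R \<omega> + \<theta>0))"
      using conj[OF z0] by blast
    define X where "X s = fst (ham_flow H s z0)" for s
    have X0: "X 0 = x" by (simp add: X_def ham_flow_traj(2) z0_def)
    \<comment> \<open>Invariance keeps the momentum on the graph, so the projected orbit solves the
      closed equation x' = H_p(x, c + v_x(x)).\<close>
    have snd_flow: "snd (ham_flow H s z0) = c + g (X s)" for s
    proof -
      obtain g' where "snd (ham_flow H s z0) = c + g'" "(v has_derivative (\<lambda>k. g' \<bullet> k)) (at (X s))"
        using inv[OF z0, of s] unfolding graph_c_def X_def by auto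
      thus ?thesis using gradient_unique[OF _ g] by blast
    qed
    have X': "(X has_vector_derivative Hp H (X s) (c + g (X s))) (at s)" for s
    proof -
      have "((\<lambda>s. ham_flow H s z0) has_vector_derivative
          (Hp H (X s) (c + g (X s)), - Hx H (X s) (c + g (X s)))) (at s)"
        using ham_flow_traj(1)[of z0] unfolding ham_traj_def by (simp add: X_def[symmetric] snd_flow)
      from bounded_linear.has_vector_derivative[OF bounded_linear_fst this]
      show ?thesis by (simp add: X_def[abs_def])
    qed
    obtain \<theta>y where \<theta>y: "\<theta>y \<in> cbox 0 1" "tor_eq y (\<phi> \<theta>y)" by (rule \<phi>_surj_mod)
    \<comment> \<open>Density is used for the difference of the initial phase and the phase of y:
      the rotated phase meets \<open>\<theta>y\<close> up to an integer vector and the error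
      \<open>e\<close>.\<close>
    obtain s z where s: "0 \<le> s" "s \<le> C * real N powr (2 * \<eta>)" and z: "int_vec z"
      and near: "norm (s *\<^sub>R \<omega> + (\<theta>0 - \<theta>y) - z) \<le> 2 * real CARD('n) ^ 2 / real N"
      using C(2)[OF N, of "\<theta>0 - \<theta>y"] by blast
    define e where "e = s *\<^sub>R \<omega> + (\<theta>0 - \<theta>y) - z"
    have e: "norm e \<le> 2 * real CARD('n) ^ 2 / real N" using near by (simp add: e_def)
    also have "\<dots> \<le> 2 * real CARD('n) ^ 2 / 1" using N by (intro divide_left_mono) auto
    finally have e1: "norm e \<le> 2 * real CARD('n) ^ 2" by simp
    have "s *\<^sub>R \<omega> + \<theta>0 = (\<theta>y + e) + z" by (simp add: e_def)
    hence "tor_eq (X s) (\<phi> ((\<theta>y + e) + z))" using \<theta>0[of s] by (simp only: X_def)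
    hence "int_vec ((X s - \<phi> ((\<theta>y + e) + z)) + (\<phi> ((\<theta>y + e) + z) - \<phi> (\<theta>y + e)))"
      using \<phi>_shift[OF z] by (intro int_vec_add) (simp_all add: tor_eq_def)
    hence "tor_eq (X s) (\<phi> (\<theta>y + e))" by (simp add: tor_eq_def)
    hence wX: "w (X s) = w (\<phi> (\<theta>y + e))" by (rule perw)
    have "w y - w (X s) = w (\<phi> \<theta>y) - w (\<phi> (\<theta>y + e))" using perw[OF \<theta>y(2)] wX by simp
    also have "\<dots> \<le> 2 * R * norm (\<phi> \<theta>y - \<phi> (\<theta>y + e))" by (rule lipw)
    also have "\<dots> \<le> 2 * R * (L * norm e)"
      using L(2)[OF \<theta>y(1) e1] R by (intro mult_left_mono) (auto simp: norm_minus_commute)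
    also have "\<dots> \<le> 2 * R * (L * (2 * real CARD('n) ^ 2 / real N))"
      using e R L by (intro mult_left_mono) auto
    finally have 1: "w y - w (X s) \<le> 2 * R * L * (2 * real CARD('n) ^ 2) / real N" by simp
    have contH: "continuous_on UNIV (\<lambda>z. H (fst z) (snd z))"
      using G by (meson has_derivative_continuous_on has_derivative_at_withinI)
    have "u (X s) - v (X s) \<le> u (X 0) - v (X 0) + (hc + \<epsilon> * K - hc) * s"
      by (rule subsolution_along_characteristic[where H = H and b = "Hp H" and g = g and c = c and R = R and B = K])
         (fact contH convex_in_momentum uD(1) ub lipu R sub g eq X' s(1) | assumption)+
    moreover have "\<epsilon> * K * s \<le> \<epsilon> * K * (C * real N powr (2 * \<eta>))"
      using s \<epsilon> K by (intro mult_left_mono) auto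
    ultimately have "w (X s) - w x \<le> K * C * (\<epsilon> * real N powr (2 * \<eta>))"
      by (simp add: w_def X0 mult_ac)
    with 1 show "(ve \<epsilon> y - v y) - (ve \<epsilon> x - v x) \<le> K * C * (\<epsilon> * real N powr (2 * \<eta>)) +
        2 * R * L * (2 * real CARD('n) ^ 2) / real N"
      by (simp add: w_def u_def)
  qed
qed

theorem theorem4p5:
  fixes H :: "real^'n \<Rightarrow> real^'n \<Rightarrow> real"
    and c :: "real^'n" and hc :: real
    and v :: "real^'n \<Rightarrow> real"
    and ve :: "real \<Rightarrow> real^'n \<Rightarrow> real"
    and \<nu> \<eta> :: real and \<omega> :: "real^'n"
  assumes "tonelli H"
    and "viscosity_solution (\<lambda>x r p. H x (c + p) - hc) v"
    and "KAM_torus H c v \<nu> \<eta> \<omega>"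
    and "\<And>\<epsilon>. \<epsilon> > 0 \<Longrightarrow> viscosity_solution (\<lambda>x r p. \<epsilon> * r + H x (c + p) - hc) (ve \<epsilon>)"
  shows "\<exists>\<beta>>0. \<forall>\<^sub>F \<epsilon> in at_right 0.
           \<exists>C. \<forall>x. \<bar>ve \<epsilon> x - (v x + C)\<bar> \<le> \<beta> * \<epsilon> powr (1 / (1 + 2 * \<eta>))"
proof -
  obtain K1 K2 where K: "K1 > 0" "K2 > 0"
    and osc: "\<And>\<epsilon> (N::nat) x y. 0 < \<epsilon> \<Longrightarrow> \<epsilon> \<le> 1 \<Longrightarrow> 2 \<le> N \<Longrightarrow>
      (ve \<epsilon> y - v y) - (ve \<epsilon> x - v x) \<le> K1 * (\<epsilon> * real N powr (2 * \<eta>)) + K2 / real N"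
    using KAM_oscillation_bound[OF assms] by blast
  have "\<eta> > real CARD('n) - 1" using assms(3) by (simp add: KAM_torus_def diophantine_def)
  moreover have "real CARD('n) \<ge> 1" by (simp add: Suc_leI)
  ultimately have eta: "\<eta> > 0" by linarith
  define \<beta> where "\<beta> = K1 * 2 powr (2 * \<eta>) + K2"
  \<comment> \<open>This threshold forces \<open>\<rho>\<close> below 1/2, so that the integer
    \<open>N\<close> of size about 1/\<open>\<rho>\<close> is at least 2.\<close>
  define \<epsilon>0 :: real where "\<epsilon>0 = (1/2) powr (1 + 2 * \<eta>)"
  have \<epsilon>0: "0 < \<epsilon>0" "\<epsilon>0 \<le> 1" using eta by (auto simp: \<epsilon>0_def intro!: powr_le1)
  \<comment> \<open>The additive constant is the value of the difference at 0, which turns the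
    oscillation bound into a sup-norm bound.\<close>
  have bound: "\<bar>ve \<epsilon> x - (v x + (ve \<epsilon> 0 - v 0))\<bar> \<le> \<beta> * \<epsilon> powr (1 / (1 + 2 * \<eta>))"
    if \<epsilon>: "0 < \<epsilon>" "\<epsilon> < \<epsilon>0" for \<epsilon> x
  proof -
    define \<rho> where "\<rho> = \<epsilon> powr (1 / (1 + 2 * \<eta>))"
    have \<rho>: "\<rho> > 0" using \<epsilon> by (simp add: \<rho>_def)
    have \<rho>\<epsilon>: "\<rho> powr (1 + 2 * \<eta>) = \<epsilon>" using \<epsilon> eta by (simp add: \<rho>_def powr_powr)
    have "\<rho> \<le> \<epsilon>0 powr (1 / (1 + 2 * \<eta>))" unfolding \<rho>_def using \<epsilon> eta by (intro powr_mono2) auto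
    also have "\<dots> = 1/2" using eta by (simp add: \<epsilon>0_def powr_powr)
    finally have \<rho>2: "2 \<le> 1 / \<rho>" using \<rho> by (simp add: field_simps)
    define N where "N = nat \<lceil>1 / \<rho>\<rceil>"
    have N: "1 / \<rho> \<le> real N" "real N \<le> 2 / \<rho>"
    proof -
      show "1 / \<rho> \<le> real N" unfolding N_def by linarith
      have "real N \<le> 1 / \<rho> + 1" unfolding N_def using \<rho>2 by linarith
      thus "real N \<le> 2 / \<rho>" using \<rho>2 by simp
    qed
    have N2: "2 \<le> N" using N(1) \<rho>2 by linarith
    have "1 / real N \<le> \<rho>" using N(1) \<rho> N2 by (simp add: field_simps)
    hence a: "K2 / real N \<le> K2 * \<rho>" using mult_left_mono[of "1 / real N" \<rho> K2] K by simp
    have "real N powr (2 * \<eta>) \<le> (2 / \<rho>) powr (2 * \<eta>)" using N eta by (intro powr_mono2) auto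
    hence "\<epsilon> * real N powr (2 * \<eta>) \<le> \<epsilon> * (2 / \<rho>) powr (2 * \<eta>)" using \<epsilon> by (intro mult_left_mono) auto
    \<comment> \<open>The balance: as \<epsilon> is \<open>\<rho>\<close> to the power 1 + 2\<eta>,
      multiplying it by \<rho>^(-2\<eta>) leaves one power of \<open>\<rho>\<close>, the same size
      as the term K2/N.\<close>
    also have "\<dots> = \<rho> powr (1 + 2 * \<eta>) * (2 powr (2 * \<eta>) / \<rho> powr (2 * \<eta>))"
      using \<rho> by (simp add: \<rho>\<epsilon> powr_divide)
    also have "\<dots> = \<rho> * 2 powr (2 * \<eta>)" using \<rho> by (simp add: powr_add)
    finally have b: "K1 * (\<epsilon> * real N powr (2 * \<eta>)) \<le> K1 * (\<rho> * 2 powr (2 * \<eta>))"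
      using K by (intro mult_left_mono) auto
    have "(ve \<epsilon> p - v p) - (ve \<epsilon> q - v q) \<le> \<beta> * \<rho>" for p q
    proof -
      have "(ve \<epsilon> p - v p) - (ve \<epsilon> q - v q) \<le> K1 * (\<epsilon> * real N powr (2 * \<eta>)) + K2 / real N"
        using \<epsilon> \<epsilon>0 N2 by (intro osc) auto
      also have "\<dots> \<le> \<beta> * \<rho>" using a b by (simp add: \<beta>_def algebra_simps)
      finally show ?thesis .
    qed
    from this[of x 0] this[of 0 x] show ?thesis by (simp add: \<rho>_def abs_le_iff)
  qed
  have "\<forall>\<^sub>F \<epsilon> in at_right 0. \<exists>C. \<forall>x. \<bar>ve \<epsilon> x - (v x + C)\<bar> \<le> \<beta> * \<epsilon> powr (1 / (1 + 2 * \<eta>))"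
    unfolding eventually_at_right_field
  proof (rule exI[of _ \<epsilon>0], intro conjI allI impI)
    show "\<epsilon>0 > 0" by fact
    fix \<epsilon> :: real assume "0 < \<epsilon>" "\<epsilon> < \<epsilon>0"
    thus "\<exists>C. \<forall>x. \<bar>ve \<epsilon> x - (v x + C)\<bar> \<le> \<beta> * \<epsilon> powr (1 / (1 + 2 * \<eta>))"
      using bound by (intro exI[of _ "ve \<epsilon> 0 - v 0"]) blast
  qed
  moreover have "\<beta> > 0" using K by (simp add: \<beta>_def add_pos_pos)
  ultimately show ?thesis by blast
qed

end
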